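(* Let $S$ be a $p\times p$ Gaussian sample covariance matrix with $m_0$ eigenvalues equal to $0$. If $$\liminf_{x\to\infty}\frac{\mathrm{pen}_D(x)}{\log x}>\frac{m_0}{p},$$ then the penalised likelihood estimate $\hat\Theta_{\mathrm{Pen}}$ exists with probability $1$.
   Context: Fix an integer $p\ge 1$. All matrices are real symmetric $p\times p$; $\Theta=(\theta_{ij})\succ 0$ means $\Theta$ is positive definite. The diagonal penalty $\mathrm{pen}_D:(0,\infty)\to\mathbb{R}$ is non-negative, non-decreasing and continuous. The off-diagonal penalty $\mathrm{pen}:\mathbb{R}\to\mathbb{R}$ is an arbitrary function that is non-negative, symmetric around $0$, non-decreasing in $|x|$ and continuous (in particular $\mathrm{pen}=0$ is allowed). Define $$\mathrm{Pen}(\Theta)=\sum_{i=1}^p \mathrm{pen}_D(\theta_{ii})+\sum_{i<j}\mathrm{pen}(\theta_{ij}),\qquad l_{\mathrm{Pen}}(\Theta\mid S)=\log\det\Theta-\mathrm{tr}(S\Theta)-\mathrm{Pen}(\Theta),\quad \Theta\succ 0.$$ The penalised likelihood estimate is $\hat\Theta_{\mathrm{Pen}}=\mathrm{argmax}_{\Theta\succ 0}\, l_{\mathrm{Pen}}(\Theta\mid S)$; it is said to exist if the supremum of $l_{\mathrm{Pen}}(\cdot\mid S)$ over positive definite $\Theta$ is finite and attained. A Gaussian sample covariance matrix is built from $X_1,\dots,X_n$ i.i.d. $N_p(\mu,\Theta_0^{-1})$ with $n\ge 1$ and $\Theta_0\succ 0$: it is $S=\frac1n\sum_{i=1}^n (X_i-\bar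 X)(X_i-\bar X)^\top$ with $\bar X=\frac1n\sum_i X_i$ when $\mu$ is unknown, or $S=\frac1n\sum_{i=1}^n (X_i-\mu)(X_i-\mu)^\top$ when $\mu$ is known. The number $m_0$ of eigenvalues of $S$ equal to $0$ is, with probability 1, the deterministic number $\max(p-n+1,0)$ in the unknown mean case and $\max(p-n,0)$ in the known mean case. *)

theory Defs
  imports
    "HOL-Probability.Probability"
    "HOL-Computational_Algebra.Polynomial"
begin

definition pos_def :: "real^'p^'p \<Rightarrow> bool" where
  "pos_def A \<longleftrightarrow> transpose A = A \<and> (\<forall>x. x \<noteq> 0 \<longrightarrow> 0 < x \<bullet> (A *v x))"

definition char_polynomial :: "real^'p^'p \<Rightarrow> real poly" where
  "char_polynomial A = det (\<chi> i j. (if i = j then [:0, 1:] else 0) - [:A $ i $ j:])"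

text \<open>Eigenvalues are counted with (algebraic) multiplicity.\<close>

definition num_zero_eigenvalues :: "real^'p^'p \<Rightarrow> nat" where
  "num_zero_eigenvalues A = order 0 (char_polynomial A)"

text \<open>The second argument of the density is the covariance matrix.\<close>

definition mvn_density :: "real^'p \<Rightarrow> real^'p^'p \<Rightarrow> real^'p \<Rightarrow> real" where
  "mvn_density \<mu> \<Sigma> x =
     exp (- ((x - \<mu>) \<bullet> (matrix_inv \<Sigma> *v (x - \<mu>))) / 2) / sqrt ((2 * pi) ^ CARD('p) * det \<Sigma>)"

definition sample_mean :: "nat \<Rightarrow> (nat \<Rightarrow> real^'p) \<Rightarrow> real^'p" where
  "sample_mean n x = (1 / real n) *\<^sub>R (\<Sum>i=1..n. x i)"

definition sample_cov_about :: "real^'p \<Rightarrow> nat \<Rightarrow> (nat \<Rightarrow> real^'p) \<Rightarrow> real^'p^'p" where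
  "sample_cov_about c n x =
     (1 / real n) *\<^sub>R (\<Sum>i=1..n. (\<chi> j k. (x i - c) $ j * (x i - c) $ k))"

text \<open>
  The diagonal penalty is a function on the positive reals; its values elsewhere are irrelevant.
\<close>

definition diag_penalty :: "(real \<Rightarrow> real) \<Rightarrow> bool" where
  "diag_penalty pen\<^sub>D \<longleftrightarrow>
     (\<forall>x>0. 0 \<le> pen\<^sub>D x) \<and> mono_on {0<..} pen\<^sub>D \<and> continuous_on {0<..} pen\<^sub>D"

definition offdiag_penalty :: "(real \<Rightarrow> real) \<Rightarrow> bool" where
  "offdiag_penalty pen \<longleftrightarrow>
     (\<forall>x. 0 \<le> pen x) \<and> (\<forall>x. pen (- x) = pen x) \<and>
     (\<forall>x y. \<bar>x\<bar> \<le> \<bar>y\<bar> \<longrightarrow> pen x \<le> pen y) \<and> continuous_on UNIV pen"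

text \<open>
  The linear order on the index type only serves to write the sum over pairs of indices \<open>i < j\<close>.
\<close>

definition Pen ::
  "(real \<Rightarrow> real) \<Rightarrow> (real \<Rightarrow> real) \<Rightarrow> real^('p::{finite,linorder})^('p::{finite,linorder}) \<Rightarrow> real" where
  "Pen pen\<^sub>D pen \<Theta> =
     (\<Sum>i\<in>UNIV. pen\<^sub>D (\<Theta> $ i $ i)) + (\<Sum>(i, j)\<in>{(i, j). i < j}. pen (\<Theta> $ i $ j))"

definition pen_loglik ::
  "(real \<Rightarrow> real) \<Rightarrow> (real \<Rightarrow> real) \<Rightarrow> real^('p::{finite,linorder})^('p::{finite,linorder}) \<Rightarrow> real^('p::{finite,linorder})^('p::{finite,linorder}) \<Rightarrow> real" where
  "pen_loglik pen\<^sub>D pen S \<Theta> = ln (det \<Theta>) - trace (S ** \<Theta>) - Pen pen\<^sub>D pen \<Theta>"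

definition pen_estimate_exists ::
  "(real \<Rightarrow> real) \<Rightarrow> (real \<Rightarrow> real) \<Rightarrow> real^('p::{finite,linorder})^('p::{finite,linorder}) \<Rightarrow> bool" where
  "pen_estimate_exists pen\<^sub>D pen S \<longleftrightarrow>
     bdd_above (pen_loglik pen\<^sub>D pen S ` {\<Theta>. pos_def \<Theta>}) \<and>
     (\<exists>\<Theta>. pos_def \<Theta> \<and>
       pen_loglik pen\<^sub>D pen S \<Theta> = (SUP \<Theta>'\<in>{\<Theta>'. pos_def \<Theta>'}. pen_loglik pen\<^sub>D pen S \<Theta>'))"

end

theory Submission
  imports Defs
begin

text \<open>
  Let \<open>J\<close> be a set of \<open>m\<^sub>0\<close> coordinates. Apply the inequality
  \<open>log det A + log det \<Theta> \<le> tr (A \<Theta>) - p\<close> to \<open>A = S + D\<close>, where \<open>D\<close> is diagonal with entries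
  \<open>1 / (1 + \<theta>\<^sub>j\<^sub>j)\<close> for \<open>j \<in> J\<close> and \<open>0\<close> elsewhere. The determinant is affine in each diagonal entry and
  non-negative on positive semidefinite matrices, so \<open>det A\<close> is at least \<open>det (S + D\<^sub>J)\<close> times the
  product of these entries, where \<open>D\<^sub>J\<close> has entries \<open>1\<close> on \<open>J\<close>. If \<open>S + D\<^sub>J\<close> is nonsingular,
  \<open>log det \<Theta> - tr (S \<Theta>)\<close> is therefore at most \<open>\<Sum>\<^sub>j\<^sub>\<in>\<^sub>J log (1 + \<theta>\<^sub>j\<^sub>j)\<close> plus a constant. Taking for \<open>J\<close>
  the \<open>m\<^sub>0\<close> smallest diagonal entries bounds this sum by \<open>m\<^sub>0 / p\<close> times the sum over all coordinates,
  which the diagonal penalty dominates; hence superlevel sets are compact.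

  It remains to see that almost surely \<open>S + D\<^sub>J\<close> is nonsingular for every \<open>J\<close> with \<open>m\<^sub>0\<close> elements. Its
  determinant is a polynomial in the data, so a single data point where it does not vanish suffices. At
  a data point where \<open>S\<close> has an \<open>m\<^sub>0\<close>-dimensional kernel this holds for some \<open>J\<close>, and permuting the
  coordinates of the data gives a point for every other \<open>J\<close>.
\<close>

section \<open>Symmetric and positive semidefinite matrices\<close>

definition diag_mat :: "('n \<Rightarrow> 'a::zero) \<Rightarrow> 'a^'n^'n" where
  "diag_mat d = (\<chi> i j. if i = j then d i else 0)"

section \<open>Spectral theorem for real symmetric matrices\<close>

lemma inner_symmetric_matrix:
  fixes A :: "real^'n^'n"
  assumes "transpose A = A"
  shows "x \<bullet> (A *v y) = (A *v x) \<bullet> y"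
  by (metis assms dot_lmul_matrix vector_transpose_matrix)

text \<open>A maximiser of the quadratic form on the unit sphere of the invariant subspace is an
  eigenvector, since the first variation vanishes there.\<close>

lemma symmetric_matrix_eigenvector:
  fixes A :: "real^'n^'n"
  assumes sym: "transpose A = A" and W: "subspace W" "\<And>x. x \<in> W \<Longrightarrow> A *v x \<in> W"
    and nontriv: "\<exists>x\<in>W. x \<noteq> 0"
  shows "\<exists>v\<in>W. norm v = 1 \<and> (\<exists>c. A *v v = c *\<^sub>R v)"
proof -
  let ?K = "W \<inter> sphere 0 1"
  have "compact ?K"
    using W(1) by (simp add: closed_subspace closed_Int_compact)
  moreover obtain x where x: "x \<in> W" "x \<noteq> 0" using nontriv by auto
  have "x /\<^sub>R norm x \<in> ?K"
    using x W(1) by (simp add: subspace_scale)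
  hence "?K \<noteq> {}" by blast
  moreover have "continuous_on ?K (\<lambda>x. x \<bullet> (A *v x))"
    by (intro continuous_intros matrix_vector_mult_linear_continuous_on)
  ultimately obtain v where v: "v \<in> ?K" and max: "\<And>y. y \<in> ?K \<Longrightarrow> y \<bullet> (A *v y) \<le> v \<bullet> (A *v v)"
    using continuous_attains_sup[of ?K "\<lambda>x. x \<bullet> (A *v x)"] by blast
  define l where "l = v \<bullet> (A *v v)"
  have le: "y \<bullet> (A *v y) \<le> l * (y \<bullet> y)" if "y \<in> W" for y
  proof (cases "y = 0")
    case False
    have "y /\<^sub>R norm y \<in> ?K" using that W(1) False by (simp add: subspace_scale)
    from max[OF this] have "(y \<bullet> (A *v y)) / (norm y)^2 \<le> l"
      by (simp add: l_def matrix_vector_mult_scaleR power2_eq_square divide_inverse mult_ac)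
    thus ?thesis using False by (simp add: dot_square_norm pos_divide_le_eq)
  qed simp
  define w where "w = A *v v - l *\<^sub>R v"
  have vW: "v \<in> W" "v \<bullet> v = 1" using v by (auto simp: dot_square_norm)
  have wW: "w \<in> W" unfolding w_def using W vW by (simp add: subspace_diff subspace_scale)
  \<comment> \<open>This is maximality of \<open>v\<close> tested at
    \<open>v + t *\<^sub>R w\<close>, where \<open>w\<close> is the residual
    \<open>A *v v - l *\<^sub>R v\<close>. The left side is linear in \<open>t\<close> and the right
    side quadratic, so small \<open>t\<close> forces \<open>w = 0\<close>.\<close>
  have quad: "2 * t * (w \<bullet> w) \<le> t^2 * (l * (w \<bullet> w) - w \<bullet> (A *v w))" for t
  proof -
    have "(v + t *\<^sub>R w) \<bullet> (A *v (v + t *\<^sub>R w)) \<le> l * ((v + t *\<^sub>R w) \<bullet> (v + t *\<^sub>R w))"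
      by (rule le) (simp add: W vW wW subspace_add subspace_scale)
    moreover have "v \<bullet> (A *v w) = (A *v v) \<bullet> w" by (rule inner_symmetric_matrix[OF sym])
    moreover have "A *v v = w + l *\<^sub>R v" by (simp add: w_def)
    moreover have "v \<bullet> (A *v v) = l" by (simp add: l_def)
    ultimately show ?thesis
      by (simp add: matrix_vector_right_distrib matrix_vector_mult_scaleR inner_add_left inner_add_right
          algebra_simps power2_eq_square vW inner_commute[of w v])
  qed
  have "w \<bullet> w \<le> 0"
  proof (rule ccontr)
    assume "\<not> ?thesis"
    hence pos: "w \<bullet> w > 0" by linarith
    define c where "c = \<bar>l * (w \<bullet> w) - w \<bullet> (A *v w)\<bar>"
    \<comment> \<open>Small enough that the quadratic term cannot reach twice
      \<open>w \<bullet> w\<close>; the \<open>+ 1\<close> keeps the denominator positive when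
      \<open>c = 0\<close>.\<close>
    define t where "t = (w \<bullet> w) / (c + 1)"
    have t: "t > 0" "t * c \<le> w \<bullet> w" using pos by (auto simp: t_def c_def field_simps)
    have "t * (2 * (w \<bullet> w)) \<le> t * (t * c)"
    proof -
      have "l * (w \<bullet> w) - w \<bullet> (A *v w) \<le> c" by (simp add: c_def)
      from mult_left_mono[OF this, of "t\<^sup>2"] quad[of t] show ?thesis
        by (simp add: power2_eq_square mult.assoc mult.left_commute)
    qed
    hence "2 * (w \<bullet> w) \<le> t * c" using t(1) by simp
    with t pos show False by linarith
  qed
  hence "w = 0" by (metis inner_ge_zero inner_eq_zero_iff order_antisym)
  hence "A *v v = l *\<^sub>R v" by (simp add: w_def)
  with v show ?thesis by auto
qed

text \<open>An orthonormal system of eigenvectors of maximal cardinality must be a basis: by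
  symmetry its orthogonal complement is invariant, so if nonzero it would contain a further
  eigenvector.\<close>

lemma symmetric_matrix_eigenbasis:
  fixes A :: "real^'n^'n"
  assumes sym: "transpose A = A"
  shows "\<exists>B. card B = CARD('n) \<and> pairwise orthogonal B \<and>
           (\<forall>b\<in>B. norm b = 1 \<and> (\<exists>c. A *v b = c *\<^sub>R b))"
proof -
  define P where "P B \<longleftrightarrow> finite B \<and> pairwise orthogonal B \<and>
           (\<forall>b\<in>B. norm b = 1 \<and> (\<exists>c. A *v b = c *\<^sub>R b))" for B
  have ind: "independent B" if "P B" for B
    by (rule pairwise_orthogonal_independent) (use that in \<open>auto simp: P_def\<close>)
  hence bound: "card B \<le> CARD('n)" if "P B" for B
    using independent_card_le[of B] that by (simp add: P_def)
  have "P {}" by (simp add: P_def)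
  hence "\<exists>B. P B \<and> (\<forall>B'. P B' \<longrightarrow> card B' \<le> card B)"
    using ex_has_greatest_nat[of P "{}" card "Suc CARD('n)"] bound by (simp add: less_Suc_eq_le)
  then obtain B where B: "P B" and max: "\<And>B'. P B' \<Longrightarrow> card B' \<le> card B" by blast
  have "card B = CARD('n)"
  proof (rule ccontr)
    assume "card B \<noteq> CARD('n)"
    hence "card B < CARD('n)" using bound[OF B] by simp
    hence "dim (span B) < DIM(real^'n)"
      using ind[OF B] dim_eq_card_independent by (simp add: dim_eq_card_independent)
    then obtain x where x: "x \<noteq> 0" "\<And>y. y \<in> span B \<Longrightarrow> orthogonal x y"
      using orthogonal_to_subspace_exists[of B] by (metis dim_span)
    let ?W = "{x. \<forall>b\<in>B. b \<bullet> x = 0}"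
    have "\<exists>v\<in>?W. norm v = 1 \<and> (\<exists>c. A *v v = c *\<^sub>R v)"
    proof (rule symmetric_matrix_eigenvector[OF sym])
      show "subspace ?W" by (auto simp: subspace_def inner_add_right)
      show "\<exists>x\<in>?W. x \<noteq> 0"
        using x by (intro bexI[of _ x]) (auto simp: orthogonal_def inner_commute span_base)
      fix y assume y: "y \<in> ?W"
      show "A *v y \<in> ?W"
      proof safe
        fix b assume b: "b \<in> B"
        then obtain c where "A *v b = c *\<^sub>R b" using B unfolding P_def by blast
        thus "b \<bullet> (A *v y) = 0" using y b by (simp add: inner_symmetric_matrix[OF sym])
      qed
    qed
    then obtain v where v: "\<forall>b\<in>B. b \<bullet> v = 0" "norm v = 1" "\<exists>c. A *v v = c *\<^sub>R v" by auto
    have "v \<notin> B" using v by fastforce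
    moreover have "P (insert v B)"
      using B v by (auto simp: P_def pairwise_insert orthogonal_def inner_commute)
    ultimately show False using max[of "insert v B"] B by (simp add: P_def)
  qed
  thus ?thesis using B by (auto simp: P_def)
qed

theorem spectral_decomposition:
  fixes A :: "real^'n^'n"
  assumes sym: "transpose A = A"
  obtains Q d where "orthogonal_matrix Q" "A = Q ** diag_mat d ** transpose Q"
proof -
  obtain B where B: "card B = CARD('n)" "pairwise orthogonal B"
     "\<And>b. b \<in> B \<Longrightarrow> norm b = 1" "\<And>b. b \<in> B \<Longrightarrow> \<exists>c. A *v b = c *\<^sub>R b"
    using symmetric_matrix_eigenbasis[OF sym] by blast
  have "finite B" using B(1) by (intro card_ge_0_finite) simp
  then obtain q :: "'n \<Rightarrow> real^'n" where q: "bij_betw q UNIV B"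
    using B(1) finite_same_card_bij[of "UNIV :: 'n set" B] by auto
  have qB: "q i \<in> B" for i using q by (auto simp: bij_betw_def)
  obtain d where d: "\<And>i. A *v q i = d i *\<^sub>R q i" using B(4)[OF qB] by metis
  define Q :: "real^'n^'n" where "Q = (\<chi> i j. q j $ i)"
  have col: "column i Q = q i" for i by (simp add: column_def Q_def vec_eq_iff)
  have Q: "orthogonal_matrix Q"
    unfolding orthogonal_matrix_orthonormal_columns col
    using B(2,3) qB q by (metis (full_types) bij_betw_def injD pairwise_def)
  have "A ** Q = Q ** diag_mat d"
  proof -
    have "(A ** Q) $ i $ j = (Q ** diag_mat d) $ i $ j" for i j
    proof -
      have "(A ** Q) $ i $ j = (A *v q j) $ i"
        by (simp add: matrix_matrix_mult_def matrix_vector_mult_def Q_def)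
      also have "\<dots> = (Q ** diag_mat d) $ i $ j"
        unfolding d by (simp add: matrix_matrix_mult_def diag_mat_def Q_def if_distrib cong: if_cong)
      finally show ?thesis .
    qed
    thus ?thesis by (simp add: vec_eq_iff)
  qed
  hence "A = Q ** diag_mat d ** transpose Q"
    using Q by (metis (no_types) matrix_mul_assoc[of A] matrix_mul_rid orthogonal_matrix_def)
  with Q show ?thesis by (rule that)
qed

section \<open>Positive semidefinite matrices: determinant and trace\<close>

definition pos_semidef :: "real^'n^'n \<Rightarrow> bool" where
  "pos_semidef A \<longleftrightarrow> transpose A = A \<and> (\<forall>x. 0 \<le> x \<bullet> (A *v x))"

lemma pos_def_imp_pos_semidef: "pos_def A \<Longrightarrow> pos_semidef A"
  unfolding pos_def_def pos_semidef_def by (metis inner_zero_left order_less_imp_le order_refl)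

lemma inner_transpose_matrix:
  fixes R :: "real^'n^'m"
  shows "x \<bullet> (transpose R *v y) = (R *v x) \<bullet> y"
  by (metis dot_lmul_matrix inner_commute transpose_matrix_vector)

lemma pos_semidef_congruence:
  assumes "pos_semidef A"
  shows "pos_semidef (transpose R ** A ** R)"
proof -
  have "x \<bullet> (transpose R ** A ** R *v x) = (R *v x) \<bullet> (A *v (R *v x))" for x
    by (simp add: inner_transpose_matrix del: transpose_matrix_vector flip: matrix_vector_mul_assoc)
  thus ?thesis using assms
    by (auto simp: pos_semidef_def matrix_transpose_mul matrix_mul_assoc)
qed

lemma inner_axis_matrix: "axis i 1 \<bullet> (A *v axis j 1) = (A :: real^'n^'n) $ i $ j"
  by (simp add: inner_axis' matrix_vector_mul_component inner_axis)

lemma pos_semidef_diag_nonneg: "pos_semidef A \<Longrightarrow> 0 \<le> A $ i $ i"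
  by (metis inner_axis_matrix pos_semidef_def)

lemma pos_def_diag_pos: "pos_def A \<Longrightarrow> 0 < A $ i $ i"
  by (metis inner_axis_matrix pos_def_def axis_eq_0_iff zero_neq_one)

lemma det_orthogonal_conjugate:
  assumes "orthogonal_matrix (Q :: real^'n^'n)"
  shows "det (Q ** A ** transpose Q) = det A"
proof -
  have "det Q * det (transpose Q) = 1"
    by (metis assms det_I det_mul orthogonal_matrix_def)
  thus ?thesis by (simp add: det_mul)
qed

lemma trace_orthogonal_conjugate:
  assumes "orthogonal_matrix (Q :: real^'n^'n)"
  shows "trace (Q ** A ** transpose Q) = trace A"
proof -
  have "trace (Q ** A ** transpose Q) = trace (transpose Q ** Q ** A)"
    by (subst trace_mul_sym) (simp add: matrix_mul_assoc)
  thus ?thesis using assms by (simp add: orthogonal_matrix_def)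
qed

lemma det_diag_mat: "det (diag_mat d) = (\<Prod>i\<in>UNIV. d i)"
  by (subst det_diagonal) (auto simp: diag_mat_def)

lemma trace_diag_mat_mult: "trace (diag_mat d ** A) = (\<Sum>i\<in>UNIV. d i * A $ i $ i)"
  by (simp add: trace_def diag_mat_def matrix_matrix_mult_def if_distrib[of "\<lambda>x. x * _"] cong: if_cong)

lemma trace_diag_mat: "trace (diag_mat d) = (\<Sum>i\<in>UNIV. d i)"
  by (simp add: trace_def diag_mat_def)

lemma diag_mat_mult_vec: "(diag_mat d *v x) $ i = d i * x $ i"
  by (simp add: diag_mat_def matrix_vector_mult_def if_distrib[of "\<lambda>x. x * _"] cong: if_cong)

lemma diag_mat_mult: "diag_mat d ** diag_mat e = (diag_mat (\<lambda>i. d i * e i) :: 'a::semiring_1^'n^'n)"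
  by (auto simp: diag_mat_def matrix_matrix_mult_def if_distrib[of "\<lambda>x. x * _"] vec_eq_iff cong: if_cong)

lemma transpose_diag_mat: "transpose (diag_mat d) = diag_mat d"
  by (auto simp: diag_mat_def transpose_def vec_eq_iff)

lemma inner_spectral_decomposition:
  assumes "A = Q ** diag_mat d ** transpose Q"
  shows "x \<bullet> (A *v x) = (\<Sum>i\<in>UNIV. d i * ((transpose Q *v x) $ i)\<^sup>2)"
proof -
  have "x \<bullet> (A *v x) = (transpose Q *v x) \<bullet> (diag_mat d *v (transpose Q *v x))"
    unfolding assms using inner_transpose_matrix[of x "transpose Q"]
    by (simp flip: matrix_vector_mul_assoc)
  also have "\<dots> = (\<Sum>i\<in>UNIV. d i * ((transpose Q *v x) $ i)\<^sup>2)"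
    by (simp add: inner_vec_def diag_mat_mult_vec power2_eq_square mult_ac)
  finally show ?thesis .
qed

text \<open>The eigenvalues are the diagonal entries of a matrix congruent to \<open>A\<close>, and
  congruence preserves semidefiniteness.\<close>

lemma pos_semidef_spectral:
  assumes "pos_semidef A"
  obtains Q d where "orthogonal_matrix Q" "A = Q ** diag_mat d ** transpose Q" "\<And>i. 0 \<le> d i"
proof -
  obtain Q d where Q: "orthogonal_matrix Q" and A: "A = Q ** diag_mat d ** transpose Q"
    using spectral_decomposition assms unfolding pos_semidef_def by blast
  have "transpose Q ** A ** Q = (transpose Q ** Q) ** diag_mat d ** (transpose Q ** Q)"
    by (simp add: A matrix_mul_assoc)
  hence "diag_mat d = transpose Q ** A ** Q"
    using Q by (simp add: orthogonal_matrix_def)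
  hence "pos_semidef (diag_mat d)" using pos_semidef_congruence[OF assms, of Q] by simp
  from pos_semidef_diag_nonneg[OF this] have "0 \<le> d i" for i by (simp add: diag_mat_def)
  with Q A show ?thesis by (rule that)
qed

lemma pos_semidef_det_nonneg: "pos_semidef A \<Longrightarrow> 0 \<le> det A"
  by (erule pos_semidef_spectral) (simp add: det_orthogonal_conjugate det_diag_mat prod_nonneg)

text \<open>The determinant is the product of the non-negative eigenvalues, so it is nonzero exactly
  when all of them are positive.\<close>

lemma pos_def_iff_pos_semidef_det: "pos_def A \<longleftrightarrow> pos_semidef A \<and> det A \<noteq> 0"
proof (intro iffI conjI)
  assume A: "pos_def A"
  thus "pos_semidef A" by (rule pos_def_imp_pos_semidef)
  have "x = 0" if "A *v x = 0" for x
    using A that unfolding pos_def_def by (metis inner_zero_right less_irrefl)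
  thus "det A \<noteq> 0"
    by (metis invertible_det_nz invertible_left_inverse matrix_left_invertible_ker)
next
  assume *: "pos_semidef A \<and> det A \<noteq> 0"
  then obtain Q d where Q: "orthogonal_matrix Q" and A: "A = Q ** diag_mat d ** transpose Q"
    and d: "\<And>i. 0 \<le> d i" using pos_semidef_spectral by blast
  have "(\<Prod>i\<in>UNIV. d i) \<noteq> 0" using * Q A by (simp add: det_orthogonal_conjugate det_diag_mat)
  hence dpos: "0 < d i" for i using d[of i] by (simp add: less_le)
  have "0 < x \<bullet> (A *v x)" if "x \<noteq> 0" for x
  proof -
    have "transpose Q *v x \<noteq> 0"
      using that Q by (metis matrix_vector_mul_assoc matrix_vector_mul_lid matrix_vector_mult_0_right orthogonal_matrix_def)
    then obtain i where "(transpose Q *v x) $ i \<noteq> 0" by (auto simp: vec_eq_iff)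
    hence "0 < (\<Sum>i\<in>UNIV. d i * ((transpose Q *v x) $ i)\<^sup>2)"
      using dpos by (intro sum_pos2[of _ i]) (auto simp: less_imp_le)
    thus ?thesis by (simp add: inner_spectral_decomposition[OF A])
  qed
  thus "pos_def A" using * by (simp add: pos_def_def pos_semidef_def)
qed

lemma pos_def_det_pos: "pos_def A \<Longrightarrow> 0 < det A"
  using pos_semidef_det_nonneg by (force simp: pos_def_iff_pos_semidef_det less_le)

text \<open>Diagonalising \<open>A\<close> turns the trace into a sum of eigenvalues of
  \<open>A\<close> times diagonal entries of a matrix congruent to \<open>B\<close>.\<close>

lemma trace_mult_pos_semidef_nonneg:
  assumes "pos_semidef A" "pos_semidef B"
  shows "0 \<le> trace (A ** B)"
proof -
  obtain Q d where "orthogonal_matrix Q" and A: "A = Q ** diag_mat d ** transpose Q"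
    and d: "\<And>i. 0 \<le> d i"
    using pos_semidef_spectral[OF assms(1)] by blast
  have "trace (A ** B) = trace (Q ** (diag_mat d ** transpose Q ** B))"
    by (simp add: A matrix_mul_assoc)
  also have "\<dots> = trace (diag_mat d ** transpose Q ** B ** Q)" by (rule trace_mul_sym)
  also have "\<dots> = trace (diag_mat d ** (transpose Q ** B ** Q))" by (simp add: matrix_mul_assoc)
  also have "\<dots> = (\<Sum>i\<in>UNIV. d i * (transpose Q ** B ** Q) $ i $ i)"
    by (rule trace_diag_mat_mult)
  finally show ?thesis
    using d pos_semidef_diag_nonneg[OF pos_semidef_congruence[OF assms(2), of Q]]
    by (simp add: sum_nonneg)
qed

text \<open>In terms of the eigenvalues \<open>e i\<close> of a suitable matrix this is
  \<open>ln (e i) \<le> e i - 1\<close>, summed over \<open>i\<close>.\<close>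

lemma ln_det_le_trace:
  fixes A T :: "real^'n^'n"
  assumes "pos_def A" "pos_def T"
  shows "ln (det A) + ln (det T) \<le> trace (A ** T) - CARD('n)"
proof -
  obtain Q d where Q: "orthogonal_matrix Q" and A: "A = Q ** diag_mat d ** transpose Q"
    and d: "\<And>i. 0 \<le> d i"
    using pos_semidef_spectral[OF pos_def_imp_pos_semidef[OF assms(1)]] by blast
  \<comment> \<open>A factor with \<open>A = transpose R ** R\<close>. The product
    \<open>A ** T\<close> need not be symmetric, but \<open>R ** T ** transpose R\<close> is, and
    has the same trace and determinant.\<close>
  define R where "R = diag_mat (\<lambda>i. sqrt (d i)) ** transpose Q"
  have "diag_mat d = diag_mat (\<lambda>i. sqrt (d i)) ** diag_mat (\<lambda>i. sqrt (d i))"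
    using d by (simp add: diag_mat_mult)
  hence "A = Q ** (diag_mat (\<lambda>i. sqrt (d i)) ** diag_mat (\<lambda>i. sqrt (d i))) ** transpose Q"
    using A by simp
  hence AR: "A = transpose R ** R"
    by (simp add: R_def matrix_transpose_mul transpose_diag_mat matrix_mul_assoc)
  define M where "M = R ** T ** transpose R"
  have "pos_semidef M"
    using pos_semidef_congruence[OF pos_def_imp_pos_semidef[OF assms(2)], of "transpose R"]
    by (simp add: M_def)
  then obtain P e where P: "orthogonal_matrix P" and M: "M = P ** diag_mat e ** transpose P"
    and e: "\<And>i. 0 \<le> e i" using pos_semidef_spectral by blast
  have det: "det A * det T = (\<Prod>i\<in>UNIV. e i)"
  proof -
    have "det A * det T = det M" by (simp add: AR M_def det_mul)
    thus ?thesis by (simp add: M det_orthogonal_conjugate[OF P] det_diag_mat)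
  qed
  have pos: "0 < det A" "0 < det T" using assms by (simp_all add: pos_def_det_pos)
  hence "(\<Prod>i\<in>UNIV. e i) \<noteq> 0" using det by (metis mult_eq_0_iff less_irrefl)
  hence epos: "0 < e i" for i using e[of i] by (simp add: less_le)
  have "ln (det A) + ln (det T) = ln (\<Prod>i\<in>UNIV. e i)"
    using pos by (simp add: ln_mult flip: det)
  also have "\<dots> = (\<Sum>i\<in>UNIV. ln (e i))" using epos by (intro ln_prod) (auto simp: less_imp_neq[symmetric])
  also have "\<dots> \<le> (\<Sum>i\<in>UNIV. e i - 1)" by (intro sum_mono ln_le_minus_one epos)
  also have "\<dots> = trace M - CARD('n)"
    by (simp add: sum_subtractf M trace_orthogonal_conjugate[OF P] trace_diag_mat)
  also have "trace M = trace (A ** T)"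
    unfolding M_def AR using trace_mul_sym[of "transpose R" "R ** T"]
    by (simp add: matrix_mul_assoc)
  finally show ?thesis .
qed

section \<open>Diagonal perturbations and the upper bound for the unpenalised likelihood\<close>

text \<open>With constant weight 1 this is the orthogonal projection onto the coordinates in
  \<open>J\<close>.\<close>

definition coord_diag :: "'n set \<Rightarrow> ('n \<Rightarrow> real) \<Rightarrow> real^'n^'n" where
  "coord_diag J d = diag_mat (\<lambda>i. if i \<in> J then d i else 0)"

lemma inner_coord_diag: "x \<bullet> (coord_diag J d *v x) = (\<Sum>i\<in>J. d i * (x $ i)\<^sup>2)"
proof -
  have "x \<bullet> (coord_diag J d *v x) = (\<Sum>i\<in>UNIV. if i \<in> J then d i * (x $ i)\<^sup>2 else 0)"
    by (auto simp: coord_diag_def inner_vec_def diag_mat_mult_vec power2_eq_square intro!: sum.cong)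
  thus ?thesis by (simp add: sum.If_cases)
qed

lemma pos_semidef_add_coord_diag:
  assumes "pos_semidef A" "\<And>i. i \<in> J \<Longrightarrow> 0 \<le> d i"
  shows "pos_semidef (A + coord_diag J d)"
proof -
  have "transpose (A + coord_diag J d) = A + coord_diag J d"
    using assms(1) by (auto simp: pos_semidef_def transpose_def vec_eq_iff coord_diag_def diag_mat_def)
  moreover have "0 \<le> x \<bullet> ((A + coord_diag J d) *v x)" for x
    using assms by (auto simp: matrix_vector_mult_add_rdistrib inner_add_right inner_coord_diag
        pos_semidef_def intro!: add_nonneg_nonneg sum_nonneg)
  ultimately show ?thesis by (simp add: pos_semidef_def)
qed

text \<open>The determinant is affine in one diagonal entry, so its value at \<open>t\<close>
  interpolates linearly between those at 0 and 1.\<close>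

lemma det_add_coord_diag_singleton:
  "det (A + coord_diag {k} (\<lambda>_. t)) = (1 - t) * det A + t * det (A + coord_diag {k} (\<lambda>_. 1))"
proof -
  \<comment> \<open>The slope of the affine function: the determinant with row \<open>k\<close>
    replaced by a unit vector.\<close>
  define g where "g = det (\<chi> i. if i = k then axis k 1 else A $ i)"
  have "det (A + coord_diag {k} (\<lambda>_. t)) = det A + t * g" for t
  proof -
    have "A + coord_diag {k} (\<lambda>_. t) = (\<chi> i. if i = k then A $ i + t *s axis k 1 else A $ i)"
      by (auto simp: vec_eq_iff coord_diag_def diag_mat_def axis_def)
    hence "det (A + coord_diag {k} (\<lambda>_. t)) = det (\<chi> i. if i = k then A $ i else A $ i) + t * g"
      by (simp add: det_row_add det_row_mul g_def)
    thus ?thesis by simp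
  qed
  from this[of t] this[of 1] show ?thesis by (simp add: algebra_simps)
qed

text \<open>Coordinates are treated one at a time: the determinant at weight \<open>d k\<close> is a
  convex combination of its values at 0 and 1, and the non-negative value at 0 is dropped. The
  matrix \<open>A\<close> is generalised because the induction hypothesis is used for
  \<open>A + coord_diag {k} (\<lambda>_. 1)\<close>.\<close>

lemma det_add_coord_diag_ge:
  assumes "finite J" "pos_semidef A" "\<And>i. i \<in> J \<Longrightarrow> 0 \<le> d i \<and> d i \<le> 1"
  shows "(\<Prod>i\<in>J. d i) * det (A + coord_diag J (\<lambda>_. 1)) \<le> det (A + coord_diag J d)"
  using assms
proof (induction J arbitrary: A)
  case empty
  then show ?case by (simp add: coord_diag_def)
next
  case (insert k J)
  have split: "coord_diag (insert k J) e = coord_diag {k} (\<lambda>_. e k) + coord_diag J e" for e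
    using insert.hyps by (auto simp: coord_diag_def diag_mat_def vec_eq_iff)
  let ?B = "A + coord_diag J d"
  have psd: "pos_semidef ?B" using insert.prems by (intro pos_semidef_add_coord_diag) auto
  have psd1: "pos_semidef (A + coord_diag {k} (\<lambda>_. 1))"
    using insert.prems by (intro pos_semidef_add_coord_diag) auto
  have dk: "0 \<le> d k" "d k \<le> 1" using insert.prems by auto
  have "(\<Prod>i\<in>insert k J. d i) * det (A + coord_diag (insert k J) (\<lambda>_. 1)) =
      d k * ((\<Prod>i\<in>J. d i) * det (A + coord_diag {k} (\<lambda>_. 1) + coord_diag J (\<lambda>_. 1)))"
    using insert.hyps by (simp add: split add_ac mult_ac)
  also have "\<dots> \<le> d k * det (A + coord_diag {k} (\<lambda>_. 1) + coord_diag J d)"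
    using insert.IH[OF psd1] insert.prems dk by (intro mult_left_mono) auto
  also have "\<dots> \<le> (1 - d k) * det ?B + d k * det (?B + coord_diag {k} (\<lambda>_. 1))"
    using dk pos_semidef_det_nonneg[OF psd] by (simp add: add_ac)
  also have "\<dots> = det (?B + coord_diag {k} (\<lambda>_. d k))"
    by (rule det_add_coord_diag_singleton[symmetric])
  finally show ?case by (simp add: split add_ac)
qed

lemma ln_det_bound:
  fixes S T :: "real^'n^'n"
  assumes S: "pos_semidef S" and nz: "det (S + coord_diag J (\<lambda>_. 1)) \<noteq> 0" and T: "pos_def T"
  shows "ln (det T) - trace (S ** T) \<le> (\<Sum>i\<in>J. ln (1 + T $ i $ i)) - ln (det (S + coord_diag J (\<lambda>_. 1)))"
proof -
  let ?D = "det (S + coord_diag J (\<lambda>_. 1))"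
  \<comment> \<open>These weights keep \<open>d i * T $ i $ i\<close> at most 1, so the perturbation
    adds at most \<open>CARD('n)\<close> to the trace, which cancels the constant in
    \<open>ln_det_le_trace\<close>. The product of the weights contributes exactly the logarithms in
    the claim.\<close>
  define d where "d i = 1 / (1 + T $ i $ i)" for i
  have Tp: "0 < T $ i $ i" for i using T by (rule pos_def_diag_pos)
  have d: "0 < d i" "d i \<le> 1" "d i * T $ i $ i \<le> 1" for i
    using Tp[of i] by (auto simp: d_def field_simps)
  let ?A = "S + coord_diag J d"
  have Dpos: "0 < ?D"
    using nz pos_semidef_det_nonneg[OF pos_semidef_add_coord_diag[OF S, of J "\<lambda>_. 1"]] by simp
  have psd: "pos_semidef ?A" using d by (intro pos_semidef_add_coord_diag S) (simp add: less_imp_le)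
  have le: "(\<Prod>i\<in>J. d i) * ?D \<le> det ?A"
    using d by (intro det_add_coord_diag_ge S) (auto simp: less_imp_le)
  have prod: "0 < (\<Prod>i\<in>J. d i)" using d by (simp add: prod_pos)
  have "0 < (\<Prod>i\<in>J. d i) * ?D" using prod Dpos by simp
  with le have "det ?A > 0" by linarith
  hence A: "pos_def ?A" using psd by (simp add: pos_def_iff_pos_semidef_det)
  have "ln (det T) \<le> trace (?A ** T) - CARD('n) - ln (det ?A)"
    using ln_det_le_trace[OF A T] by simp
  moreover have "trace (?A ** T) = trace (S ** T) + (\<Sum>i\<in>UNIV. if i \<in> J then d i * T $ i $ i else 0)"
  proof -
    have "trace (?A ** T) = trace (S ** T) + trace (coord_diag J d ** T)"
      by (simp add: trace_mul_sym[of _ T] matrix_add_ldistrib trace_add)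
    thus ?thesis
      by (simp add: coord_diag_def trace_diag_mat_mult if_distrib[of "\<lambda>x. x * _"] cong: if_cong)
  qed
  moreover have "(\<Sum>i\<in>UNIV. if i \<in> J then d i * T $ i $ i else 0) \<le> (\<Sum>i\<in>(UNIV::'n set). 1)"
    by (intro sum_mono) (use d in auto)
  moreover have "ln ((\<Prod>i\<in>J. d i) * ?D) \<le> ln (det ?A)"
    using le \<open>0 < (\<Prod>i\<in>J. d i) * ?D\<close> by (intro ln_mono) auto
  moreover have "ln ((\<Prod>i\<in>J. d i) * ?D) = (\<Sum>i\<in>J. ln (d i)) + ln ?D"
  proof -
    have "ln (\<Prod>i\<in>J. d i) = (\<Sum>i\<in>J. ln (d i))"
      using d by (intro ln_prod) (auto simp: less_imp_neq[symmetric])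
    thus ?thesis by (simp add: ln_mult_pos[OF prod Dpos])
  qed
  moreover have "(\<Sum>i\<in>J. ln (d i)) = - (\<Sum>i\<in>J. ln (1 + T $ i $ i))"
    using Tp by (simp add: d_def ln_divide_pos add_pos_pos flip: sum_negf)
  ultimately show ?thesis by simp
qed

text \<open>Downward induction on \<open>m\<close> from the full index set: removing an index with
  the largest value of \<open>g\<close> does not increase the average over the remaining
  set.\<close>

lemma subset_sum_le_proportion:
  fixes g :: "'n::finite \<Rightarrow> real"
  assumes "m \<le> CARD('n)"
  shows "\<exists>J. card J = m \<and> CARD('n) * (\<Sum>i\<in>J. g i) \<le> m * (\<Sum>i\<in>UNIV. g i)"
  using assms
proof (induction rule: inc_induct)
  case base
  show ?case by (rule exI[of _ UNIV]) simp
next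
  case (step m)
  then obtain J :: "'n set" where J: "card J = Suc m" "CARD('n) * (\<Sum>i\<in>J. g i) \<le> Suc m * (\<Sum>i\<in>UNIV. g i)"
    by blast
  hence "J \<noteq> {}" by auto
  then obtain k where k: "k \<in> J" "\<And>i. i \<in> J \<Longrightarrow> g i \<le> g k"
    using Max_in[of "g ` J"] Max_ge[of "g ` J"] by fastforce
  have sum: "(\<Sum>i\<in>J. g i) = g k + (\<Sum>i\<in>J-{k}. g i)" using k by (simp add: sum.remove)
  have "(\<Sum>i\<in>J. g i) \<le> (\<Sum>i\<in>J. g k)" by (intro sum_mono k)
  hence "(\<Sum>i\<in>J. g i) \<le> Suc m * g k" using J by simp
  hence "Suc m * (\<Sum>i\<in>J-{k}. g i) \<le> m * (\<Sum>i\<in>J. g i)"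
    by (simp add: sum algebra_simps)
  hence "CARD('n) * (Suc m * (\<Sum>i\<in>J-{k}. g i)) \<le> CARD('n) * (m * (\<Sum>i\<in>J. g i))"
    by (intro mult_left_mono) auto
  also have "\<dots> = m * (CARD('n) * (\<Sum>i\<in>J. g i))" by simp
  also have "\<dots> \<le> m * (Suc m * (\<Sum>i\<in>UNIV. g i))" by (intro mult_left_mono J) auto
  finally have "Suc m * (CARD('n) * (\<Sum>i\<in>J-{k}. g i)) \<le> Suc m * (m * (\<Sum>i\<in>UNIV. g i))"
    by (simp add: mult_ac del: of_nat_Suc)
  hence "CARD('n) * (\<Sum>i\<in>J-{k}. g i) \<le> m * (\<Sum>i\<in>UNIV. g i)"
    by (subst (asm) mult_le_cancel_left_pos) auto
  moreover have "card (J - {k}) = m" using J k by simp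
  ultimately show ?case by blast
qed

section \<open>Existence of the estimate for generic matrices\<close>

text \<open>Testing the form on the sum and the difference of two unit vectors bounds twice the
  modulus of the entry by the sum of two diagonal entries.\<close>

lemma pos_semidef_entry_bound:
  assumes A: "pos_semidef A" and b: "\<And>i. A $ i $ i \<le> b"
  shows "\<bar>A $ i $ j\<bar> \<le> b"
proof -
  have sym: "A $ j $ i = A $ i $ j"
    using A unfolding pos_semidef_def by (metis transpose_def vec_lambda_beta)
  have "0 \<le> (axis i 1 + s *\<^sub>R axis j 1) \<bullet> (A *v (axis i 1 + s *\<^sub>R axis j 1))" for s
    using A by (simp add: pos_semidef_def)
  hence "0 \<le> A $ i $ i + 2 * s * A $ i $ j + s * s * A $ j $ j" for s
    by (simp add: matrix_vector_right_distrib matrix_vector_mult_scaleR inner_add_left inner_add_right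
        inner_axis_matrix sym algebra_simps)
  from this[of 1] this[of "-1"] b[of i] b[of j] show ?thesis by auto
qed

lemma continuous_on_det: "continuous_on X (det :: real^'n^'n \<Rightarrow> real)"
  unfolding det_def by (intro continuous_intros)

lemma continuous_on_trace_mult: "continuous_on X (\<lambda>T. trace (S ** T :: real^'n^'n))"
  unfolding trace_def matrix_matrix_mult_def
  by (simp, intro continuous_intros)

lemma closed_pos_semidef: "closed {A. pos_semidef (A :: real^'n^'n)}"
proof -
  have "closed {A :: real^'n^'n. transpose A = A}"
    unfolding vec_eq_iff transpose_def
    by (simp, intro closed_Collect_all closed_Collect_eq continuous_intros)
  moreover have "closed {A :: real^'n^'n. \<forall>x. 0 \<le> x \<bullet> (A *v x)}"
    unfolding inner_vec_def matrix_vector_mult_def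
    by (simp, intro closed_Collect_all closed_Collect_le continuous_intros)
  ultimately show ?thesis
    unfolding pos_semidef_def by (rule closed_Collect_conj)
qed

text \<open>The diagonal bound controls all entries, and all conditions are closed. For
  \<open>0 < e\<close> every member is positive definite, so the closed condition of
  semidefiniteness admits no singular limits.\<close>

lemma compact_pos_semidef_level:
  "compact {A :: real^'n^'n. pos_semidef A \<and> (\<forall>i. A $ i $ i \<le> b) \<and> e \<le> det A}" (is "compact ?C")
proof -
  have "norm A \<le> (\<Sum>i\<in>(UNIV::'n set). \<Sum>j\<in>(UNIV::'n set). b)" if "A \<in> ?C" for A
  proof -
    have "norm A \<le> (\<Sum>i\<in>UNIV. norm (A $ i))" by (simp add: norm_vec_def L2_set_le_sum)
    also have "\<dots> \<le> (\<Sum>i\<in>UNIV. \<Sum>j\<in>UNIV. \<bar>A $ i $ j\<bar>)" by (intro sum_mono norm_le_l1_cart)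
    also have "\<dots> \<le> (\<Sum>i\<in>(UNIV::'n set). \<Sum>j\<in>(UNIV::'n set). b)"
      using that by (intro sum_mono pos_semidef_entry_bound) auto
    finally show ?thesis .
  qed
  hence "bounded ?C" by (rule boundedI)
  moreover have "closed ?C"
    by (intro closed_Collect_conj closed_pos_semidef closed_Collect_all closed_Collect_le
        continuous_on_det continuous_intros)
  ultimately show ?thesis by (simp add: compact_eq_bounded_closed)
qed

section \<open>Growth of the penalty and attainment of the supremum\<close>

text \<open>Rewrites the growth condition in the terms \<open>ln (1 + x)\<close> of
  \<open>ln_det_bound\<close>, uniformly for positive \<open>x\<close>. For large \<open>x\<close>
  the constant absorbs the \<open>ln 2\<close> from \<open>1 + x \<le> 2 * x\<close>; below the
  threshold \<open>x0\<close> it absorbs the whole logarithm, as the penalty is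
  non-negative.\<close>

lemma diag_penalty_lower_bound:
  assumes "diag_penalty pen\<^sub>D" and "0 \<le> \<kappa>"
    and "Liminf at_top (\<lambda>x. ereal (pen\<^sub>D x / ln x)) > ereal \<kappa>"
  obtains c C where "\<kappa> < c" "\<And>x. 0 < x \<Longrightarrow> c * ln (1 + x) - C \<le> pen\<^sub>D x"
proof -
  obtain c where c: "\<kappa> < c" "ereal c < Liminf at_top (\<lambda>x. ereal (pen\<^sub>D x / ln x))"
    using ereal_dense2[OF assms(3)] by auto
  have "eventually (\<lambda>x. c < pen\<^sub>D x / ln x \<and> 1 < x) at_top"
    using less_LiminfD[OF c(2)] eventually_gt_at_top[of 1] by eventually_elim simp
  then obtain x0 where x0: "\<And>x. x0 \<le> x \<Longrightarrow> c < pen\<^sub>D x / ln x \<and> 1 < x"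
    by (auto simp: eventually_at_top_linorder)
  have x0': "1 < x0" using x0[of x0] by simp
  have cpos: "0 < c" using c(1) assms(2) by simp
  have "c * ln (1 + x) - (c * ln 2 + c * ln (1 + x0)) \<le> pen\<^sub>D x" if "0 < x" for x
  proof (cases "x0 \<le> x")
    case True
    hence *: "c < pen\<^sub>D x / ln x" "1 < x" using x0 by auto
    hence "c * ln x \<le> pen\<^sub>D x" by (simp add: pos_less_divide_eq)
    moreover have "ln (1 + x) \<le> ln (2 * x)" using * by (intro ln_mono) auto
    hence "ln (1 + x) \<le> ln 2 + ln x" using * by (simp add: ln_mult)
    hence "c * ln (1 + x) \<le> c * (ln 2 + ln x)" using cpos by simp
    moreover have "0 \<le> c * ln (1 + x0)" using cpos x0' by simp
    ultimately show ?thesis by (simp add: algebra_simps)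
  next
    case False
    hence "c * ln (1 + x) \<le> c * ln (1 + x0)" using cpos that by simp
    moreover have "0 \<le> c * ln 2" using cpos by simp
    moreover have "0 \<le> pen\<^sub>D x" using assms(1) that by (simp add: diag_penalty_def)
    ultimately show ?thesis by linarith
  qed
  with c(1) show ?thesis by (rule that)
qed

lemma continuous_on_pen_loglik:
  assumes "diag_penalty pen\<^sub>D" "offdiag_penalty pen" "\<And>T. T \<in> X \<Longrightarrow> pos_def T"
  shows "continuous_on X (pen_loglik pen\<^sub>D pen S)"
proof -
  have D: "continuous_on X (\<lambda>T. pen\<^sub>D (T $ i $ i))" for i
  proof (rule continuous_on_compose2[of "{0<..}" pen\<^sub>D])
    show "continuous_on {0<..} pen\<^sub>D" using assms(1) by (simp add: diag_penalty_def)
  qed (use assms(3) pos_def_diag_pos in \<open>auto intro!: continuous_intros\<close>)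
  have O: "continuous_on X (\<lambda>T. pen (T $ i $ j))" for i j
  proof (rule continuous_on_compose2[of UNIV pen])
    show "continuous_on UNIV pen" using assms(2) by (simp add: offdiag_penalty_def)
  qed (auto intro!: continuous_intros)
  have "continuous_on X (\<lambda>T. ln (det T))"
    by (intro continuous_on_ln continuous_on_det) (use assms(3) pos_def_det_pos in force)
  moreover have "continuous_on X (\<lambda>T. Pen pen\<^sub>D pen T)"
    unfolding Pen_def case_prod_unfold by (intro continuous_intros D O)
  ultimately show ?thesis
    unfolding pen_loglik_def[abs_def] by (intro continuous_on_diff continuous_on_trace_mult)
qed

lemma pen_estimate_existsI:
  fixes S :: "real^('p::{finite,linorder})^('p::{finite,linorder})"
  assumes S: "pos_semidef S"
    and generic: "\<And>J. card J = m \<Longrightarrow> det (S + coord_diag J (\<lambda>_. 1)) \<noteq> 0"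
    and m: "m \<le> CARD('p)"
    and D: "diag_penalty pen\<^sub>D" and O: "offdiag_penalty pen"
    and lim: "Liminf at_top (\<lambda>x. ereal (pen\<^sub>D x / ln x)) > ereal (real m / real CARD('p))"
  shows "pen_estimate_exists pen\<^sub>D pen S"
proof -
  let ?l = "pen_loglik pen\<^sub>D pen S"
  define \<kappa> where "\<kappa> = real m / real CARD('p)"
  obtain c C where c: "\<kappa> < c" and C: "\<And>x. 0 < x \<Longrightarrow> c * ln (1 + x) - C \<le> pen\<^sub>D x"
    using diag_penalty_lower_bound[OF D _ lim] unfolding \<kappa>_def by auto
  define K where "K = (\<Sum>J\<in>(UNIV :: 'p set set). \<bar>ln (det (S + coord_diag J (\<lambda>_. 1)))\<bar>) + CARD('p) * C"
  have Off: "0 \<le> (\<Sum>(i, j)\<in>{(i, j). i < j}. pen (T $ i $ j))" for T :: "((real, 'p) vec, 'p) vec"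
    using O by (intro sum_nonneg) (auto simp: offdiag_penalty_def)
  \<comment> \<open>Coercivity: the penalty contributes the coefficient \<open>c\<close>, the
    likelihood at most \<open>\<kappa>\<close>, so each large diagonal entry lowers the
    value.\<close>
  have upper: "?l T \<le> K - (c - \<kappa>) * (\<Sum>i\<in>UNIV. ln (1 + T $ i $ i))" if T: "pos_def T" for T
  proof -
    let ?g = "\<lambda>i. ln (1 + T $ i $ i)"
    obtain J where J: "card J = m" "CARD('p) * (\<Sum>i\<in>J. ?g i) \<le> m * (\<Sum>i\<in>UNIV. ?g i)"
      using subset_sum_le_proportion[OF m, of ?g] by blast
    have "ln (det T) - trace (S ** T) \<le> (\<Sum>i\<in>J. ?g i) - ln (det (S + coord_diag J (\<lambda>_. 1)))"
      by (rule ln_det_bound[OF S generic[OF J(1)] T])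
    moreover have "(\<Sum>i\<in>J. ?g i) \<le> \<kappa> * (\<Sum>i\<in>UNIV. ?g i)"
      using J(2) by (simp add: \<kappa>_def field_simps)
    moreover have "\<bar>ln (det (S + coord_diag J (\<lambda>_. 1)))\<bar> \<le> K - CARD('p) * C"
      unfolding K_def by (simp, intro member_le_sum) auto
    moreover have "(\<Sum>i\<in>UNIV. c * ?g i - C) \<le> (\<Sum>i\<in>UNIV. pen\<^sub>D (T $ i $ i))"
      by (intro sum_mono C pos_def_diag_pos T)
    hence "c * (\<Sum>i\<in>UNIV. ?g i) - CARD('p) * C \<le> (\<Sum>i\<in>UNIV. pen\<^sub>D (T $ i $ i))"
      by (simp add: sum_subtractf sum_distrib_left)
    ultimately show ?thesis
      using Off[of T] by (simp add: pen_loglik_def Pen_def algebra_simps)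
  qed
  \<comment> \<open>The value at the identity is the reference level; \<open>b\<close> is the
    diagonal bound obtained by solving \<open>upper\<close> for values of at least
    \<open>l0\<close>.\<close>
  define l0 where "l0 = ?l (mat 1)"
  define b where "b = exp ((K - l0) / (c - \<kappa>))"
  \<comment> \<open>A compact set containing the superlevel set of \<open>l0\<close>. The lower
    bound on the determinant holds there because the trace and the penalties are
    non-negative.\<close>
  define X where "X = {A :: ((real, 'p) vec, 'p) vec. pos_semidef A \<and> (\<forall>i. A $ i $ i \<le> b) \<and> exp l0 \<le> det A}"
  have Xpd: "pos_def T" if "T \<in> X" for T
    using that exp_gt_zero[of l0] unfolding X_def pos_def_iff_pos_semidef_det
    by (auto simp del: exp_gt_zero)
  have mem: "T \<in> X" if T: "pos_def T" and le: "l0 \<le> ?l T" for T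
  proof -
    have pos: "0 < T $ i $ i" for i using T by (rule pos_def_diag_pos)
    have "T $ i $ i \<le> b" for i
    proof -
      have "ln (1 + T $ i $ i) \<le> (\<Sum>i\<in>UNIV. ln (1 + T $ i $ i))"
        using pos by (intro member_le_sum) (auto simp: less_imp_le)
      hence "(c - \<kappa>) * ln (1 + T $ i $ i) \<le> K - l0"
        using upper[OF T] le c mult_left_mono[of _ _ "c - \<kappa>"] by (smt (verit))
      hence "ln (1 + T $ i $ i) \<le> (K - l0) / (c - \<kappa>)" using c by (simp add: field_simps)
      hence "1 + T $ i $ i \<le> b" using pos[of i] unfolding b_def by (metis add_pos_pos exp_le_cancel_iff exp_ln zero_less_one)
      thus ?thesis by simp
    qed
    moreover have "l0 \<le> ln (det T)"
    proof -
      have "0 \<le> trace (S ** T)"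
        by (rule trace_mult_pos_semidef_nonneg[OF S pos_def_imp_pos_semidef[OF T]])
      moreover have "0 \<le> (\<Sum>i\<in>UNIV. pen\<^sub>D (T $ i $ i))"
        using D pos by (intro sum_nonneg) (simp add: diag_penalty_def)
      ultimately show ?thesis using le Off[of T] by (simp add: pen_loglik_def Pen_def)
    qed
    hence "exp l0 \<le> det T" using pos_def_det_pos[OF T] by (metis exp_le_cancel_iff exp_ln)
    ultimately show ?thesis using T by (simp add: X_def pos_def_imp_pos_semidef)
  qed
  have I: "pos_def (mat 1 :: ((real, 'p) vec, 'p) vec)" by (simp add: pos_def_def)
  have "\<exists>T\<in>X. \<forall>T'\<in>X. ?l T' \<le> ?l T"
    using mem[OF I] compact_pos_semidef_level Xpd
    by (intro continuous_attains_sup continuous_on_pen_loglik D O) (auto simp: X_def l0_def)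
  then obtain T where T: "T \<in> X" and max: "\<And>T'. T' \<in> X \<Longrightarrow> ?l T' \<le> ?l T" by blast
  \<comment> \<open>Outside \<open>X\<close> the value is below \<open>l0\<close>, which the
    identity, a member of \<open>X\<close>, already attains.\<close>
  have glob: "?l T' \<le> ?l T" if "pos_def T'" for T'
    using max[of T'] max[of "mat 1"] mem[OF I] mem[OF that] by (force simp: l0_def)
  have "?l T = (SUP T'\<in>{T'. pos_def T'}. ?l T')"
    by (rule cSup_eq_maximum[symmetric]) (use glob Xpd[OF T] in auto)
  moreover have "bdd_above (?l ` {T. pos_def T})"
    using glob by (intro bdd_aboveI[of _ "?l T"]) auto
  ultimately show ?thesis using Xpd[OF T] unfolding pen_estimate_exists_def by blast
qed

section \<open>Kernels and zero eigenvalues\<close>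

lemma poly_char_polynomial:
  "poly (char_polynomial A) t = det ((\<chi> i j. if i = j then t else 0) - A)"
  unfolding char_polynomial_def det_def
  by (auto simp: poly_sum poly_prod intro!: sum.cong prod.cong)

lemma order_zero_prod_linear:
  assumes "finite I"
  shows "order 0 (\<Prod>i\<in>I. [:- d i, 1:] :: 'a::field poly) = card {i \<in> I. d i = 0}"
  using assms
proof (induction I rule: finite_induct)
  case (insert k I)
  have ne: "[:- d k, 1:] * (\<Prod>i\<in>I. [:- d i, 1:]) \<noteq> (0 :: 'a poly)"
    using insert.hyps by (intro no_zero_divisors) simp_all
  have "order 0 [:- d k, 1:] = (if d k = 0 then 1 else 0)"
    using order_power_n_n[of "0::'a" 1] by (auto intro: order_0I)
  moreover have "{i \<in> insert k I. d i = 0} = (if d k = 0 then insert k {i \<in> I. d i = 0} else {i \<in> I. d i = 0})"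
    by auto
  ultimately show ?case
    using insert by (simp add: order_mult[OF ne] del: mult_pCons_left)
qed simp

text \<open>Orthogonal conjugation fixes multiples of the identity, hence the characteristic
  polynomial, which therefore splits into linear factors with roots \<open>d i\<close>. Equality of
  the polynomials is checked by evaluation at every real \<open>t\<close>.\<close>

lemma num_zero_eigenvalues_spectral:
  assumes Q: "orthogonal_matrix Q" and A: "A = Q ** diag_mat d ** transpose Q"
  shows "num_zero_eigenvalues A = card {i. d i = 0}"
proof -
  have "poly (char_polynomial A) t = poly (\<Prod>i\<in>UNIV. [:- d i, 1:]) t" for t
  proof -
    have "Q ** mat t ** transpose Q = mat t"
    proof -
      have "Q ** mat t = mat t ** Q"
        by (auto simp: vec_eq_iff matrix_matrix_mult_def mat_def if_distrib if_distribR cong: if_cong)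
      hence "Q ** mat t ** transpose Q = mat t ** (Q ** transpose Q)" by (simp add: matrix_mul_assoc)
      thus ?thesis using Q by (simp add: orthogonal_matrix_def)
    qed
    moreover have "Q ** (mat t - diag_mat d) ** transpose Q = Q ** mat t ** transpose Q - A"
      unfolding A by (auto simp: vec_eq_iff matrix_matrix_mult_def algebra_simps sum_subtractf sum_distrib_left)
    ultimately have "(\<chi> i j. if i = j then t else 0) - A = Q ** (mat t - diag_mat d) ** transpose Q"
      by (simp add: mat_def)
    also have "mat t - diag_mat d = diag_mat (\<lambda>i. t - d i)"
      by (auto simp: vec_eq_iff mat_def diag_mat_def)
    finally show ?thesis
      by (simp add: poly_char_polynomial det_orthogonal_conjugate[OF Q] det_diag_mat poly_prod)
  qed
  hence "char_polynomial A = (\<Prod>i\<in>UNIV. [:- d i, 1:])" by (subst poly_eq_poly_eq_iff[symmetric]) (rule ext)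
  thus ?thesis by (simp add: num_zero_eigenvalues_def order_zero_prod_linear)
qed

text \<open>Algebraic and geometric multiplicity of the eigenvalue 0 agree: \<open>Q\<close> carries
  the kernel of the diagonal matrix, a coordinate subspace, onto that of \<open>A\<close>.\<close>

lemma dim_kernel_eq_num_zero_eigenvalues:
  fixes A :: "real^'n^'n"
  assumes "transpose A = A"
  shows "dim {x. A *v x = 0} = num_zero_eigenvalues A"
proof -
  obtain Q d where Q: "orthogonal_matrix Q" and A: "A = Q ** diag_mat d ** transpose Q"
    using spectral_decomposition[OF assms] by blast
  let ?K = "{x :: real^'n. \<forall>i. i \<notin> {i. d i = 0} \<longrightarrow> x $ i = 0}"
  have QQ: "transpose Q *v (Q *v x) = x" "Q *v (transpose Q *v x) = x" for x
    using Q by (simp_all add: matrix_vector_mul_assoc orthogonal_matrix_def del: transpose_matrix_vector)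
  have diag0: "diag_mat d *v y = 0 \<longleftrightarrow> y \<in> ?K" for y
    by (auto simp: vec_eq_iff diag_mat_mult_vec)
  have Q0: "Q *v z = 0 \<longleftrightarrow> z = 0" for z
    using QQ(1)[of z] by (metis matrix_vector_mult_0_right)
  have iff: "A *v x = 0 \<longleftrightarrow> transpose Q *v x \<in> ?K" for x
  proof -
    have "A *v x = Q *v (diag_mat d *v (transpose Q *v x))"
      by (simp add: A matrix_vector_mul_assoc matrix_mul_assoc del: transpose_matrix_vector)
    thus ?thesis by (simp only: Q0 diag0)
  qed
  have "{x. A *v x = 0} = (*v) Q ` ?K"
  proof (intro set_eqI iffI)
    fix x assume "x \<in> {x. A *v x = 0}"
    hence "transpose Q *v x \<in> ?K" by (simp only: iff mem_Collect_eq)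
    thus "x \<in> (*v) Q ` ?K" by (rule image_eqI[rotated]) (simp only: QQ(2))
  next
    fix x assume "x \<in> (*v) Q ` ?K"
    then obtain y where y: "y \<in> ?K" "x = Q *v y" by blast
    hence "transpose Q *v x \<in> ?K" by (simp only: QQ(1))
    thus "x \<in> {x. A *v x = 0}" by (simp only: iff mem_Collect_eq)
  qed
  moreover have "inj ((*v) Q)" by (metis QQ(1) injI)
  ultimately have "dim {x. A *v x = 0} = dim ?K"
    using dim_image_eq[OF matrix_vector_mul_linear[of Q], of ?K] by (simp add: inj_on_def)
  also have "\<dots> = card {i. d i = 0}"
    unfolding dim_vec_eq[symmetric] by (rule dim_substandard_cart)
  finally show ?thesis by (simp add: num_zero_eigenvalues_spectral[OF Q A])
qed

section \<open>Coordinates that detect the kernel\<close>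

text \<open>A basis of \<open>V\<close> is extended to the whole space by a set \<open>E\<close> of
  standard unit vectors, and \<open>J\<close> collects the coordinates whose unit vectors are not in
  \<open>E\<close>. A vector of \<open>V\<close> vanishing on \<open>J\<close> lies in
  \<open>span E\<close>, which meets \<open>V\<close> only in 0.\<close>

lemma subspace_coordinate_complement:
  fixes V :: "(real^'n) set"
  assumes "subspace V"
  obtains J where "card J = dim V" "\<forall>x\<in>V. (\<forall>j\<in>J. x $ j = 0) \<longrightarrow> x = 0"
proof -
  obtain B where B: "B \<subseteq> V" "independent B" "V \<subseteq> span B" "card B = dim V"
    using basis_exists by metis
  obtain B' where B': "B \<subseteq> B'" "B' \<subseteq> B \<union> Basis" "independent B'" "B \<union> Basis \<subseteq> span B'"
    using maximal_independent_subset_extend[of B "B \<union> Basis"] B(2) by blast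
  define E where "E = B' - B"
  have span: "span B' = UNIV"
    using B'(4) by (metis span_Basis span_mono span_span sup.boundedE top.extremum_uniqueI)
  have fin: "finite B'" using B'(3) by (rule independent_imp_finite)
  have "card B' = CARD('n)"
    using B'(3) span dim_eq_card_independent[of B'] by (metis dim_UNIV dim_span DIM_cart DIM_real mult.right_neutral)
  hence cards: "card B + card E = CARD('n)"
    using fin B'(1) unfolding E_def by (metis card_Diff_subset card_mono finite_subset le_add_diff_inverse)
  have indE: "independent E" using B'(3) by (rule independent_mono) (auto simp: E_def)
  \<comment> \<open>The dimension formula yields the trivial intersection, because the sum of the
    two spans is everything and their dimensions add up to \<open>CARD('n)\<close>.\<close>
  have "dim {x + y |x y. x \<in> span B \<and> y \<in> span E} + dim (span B \<inter> span E) = dim (span B) + dim (span E)"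
    by (intro dim_sums_Int) auto
  moreover have "{x + y |x y. x \<in> span B \<and> y \<in> span E} = UNIV"
    using span span_Un[of B E] B'(1) by (simp add: E_def Un_absorb1)
  ultimately have "dim (span B \<inter> span E) = 0"
    using cards B(2) indE by (simp add: dim_eq_card_independent)
  hence disj: "span B \<inter> span E \<subseteq> {0}" by simp
  define J where "J = {j. axis j (1::real) \<notin> E}"
  have "E \<subseteq> Basis" using B'(2) by (auto simp: E_def)
  hence "E = (\<lambda>j. axis j 1) ` (- J)"
    by (auto simp: J_def Basis_vec_def)
  moreover have "inj_on (\<lambda>j. axis j (1::real)) (- J)" by (auto simp: inj_on_def axis_eq_axis)
  ultimately have "card E = card (- J)" by (metis card_image)
  hence "card J = dim V"
    using cards B(4) card_mono[of UNIV J] by (simp add: Compl_eq_Diff_UNIV card_Diff_subset)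
  moreover have "x = 0" if x: "x \<in> V" "\<forall>j\<in>J. x $ j = 0" for x
  proof -
    have "(\<Sum>i\<in>UNIV. (x $ i) *s axis i 1) \<in> span E"
    proof (rule span_sum)
      fix i show "(x $ i) *s axis i 1 \<in> span E"
      proof (cases "i \<in> J")
        case False
        thus ?thesis unfolding scalar_mult_eq_scaleR by (intro span_scale span_base) (simp add: J_def)
      qed (simp add: x(2) span_zero)
    qed
    hence "x \<in> span E" by (simp add: basis_expansion)
    thus ?thesis using disj x(1) B(3) by auto
  qed
  ultimately show ?thesis using that by blast
qed

text \<open>In eigencoordinates the form is a sum of non-negative terms, so each term
  vanishes.\<close>

lemma pos_semidef_kernel:
  assumes "pos_semidef A" "x \<bullet> (A *v x) = 0"
  shows "A *v x = 0"
proof -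
  obtain Q d where "orthogonal_matrix Q" and A: "A = Q ** diag_mat d ** transpose Q" and d: "\<And>i. 0 \<le> d i"
    using pos_semidef_spectral[OF assms(1)] by blast
  have "(\<Sum>i\<in>UNIV. d i * ((transpose Q *v x) $ i)\<^sup>2) = 0"
    using assms(2) inner_spectral_decomposition[OF A] by metis
  hence "d i * ((transpose Q *v x) $ i)\<^sup>2 = 0" for i
    by (subst (asm) sum_nonneg_eq_0_iff) (auto simp: d simp del: transpose_matrix_vector)
  hence "diag_mat d *v (transpose Q *v x) = 0"
    by (simp add: vec_eq_iff diag_mat_mult_vec del: transpose_matrix_vector)
  thus ?thesis unfolding A matrix_vector_mul_assoc[symmetric] by simp
qed

text \<open>Take \<open>J\<close> such that no nonzero kernel vector of \<open>A\<close> vanishes on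
  it. A kernel vector of the perturbed matrix annihilates both non-negative quadratic forms, so it
  lies in the kernel of \<open>A\<close> and vanishes on \<open>J\<close>.\<close>

lemma exists_nonsingular_coord_diag:
  fixes A :: "real^'n^'n"
  assumes A: "pos_semidef A"
  obtains J where "card J = num_zero_eigenvalues A" "det (A + coord_diag J (\<lambda>_. 1)) \<noteq> 0"
proof -
  have sub: "subspace {x. A *v x = 0}"
    by (auto simp: subspace_def matrix_vector_right_distrib matrix_vector_mult_scaleR)
  obtain J where J: "card J = dim {x. A *v x = 0}"
    "\<forall>x\<in>{x. A *v x = 0}. (\<forall>j\<in>J. x $ j = 0) \<longrightarrow> x = 0"
    by (rule subspace_coordinate_complement[OF sub])
  let ?B = "A + coord_diag J (\<lambda>_. 1)"
  have "x = 0" if x: "?B *v x = 0" for x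
  proof -
    have "x \<bullet> (A *v x) + (\<Sum>i\<in>J. (x $ i)\<^sup>2) = 0"
      using arg_cong[OF x, of "\<lambda>y. x \<bullet> y"]
      by (simp add: matrix_vector_mult_add_rdistrib inner_add_right inner_coord_diag)
    moreover have "0 \<le> x \<bullet> (A *v x)" using A by (simp add: pos_semidef_def)
    moreover have "0 \<le> (\<Sum>i\<in>J. (x $ i)\<^sup>2)" by (simp add: sum_nonneg)
    ultimately have *: "x \<bullet> (A *v x) = 0" "(\<Sum>i\<in>J. (x $ i)\<^sup>2) = 0" by linarith+
    from *(2) have "x $ j = 0" if "j \<in> J" for j
      using that by (subst (asm) sum_nonneg_eq_0_iff) auto
    with J(2) pos_semidef_kernel[OF A *(1)] show ?thesis by blast
  qed
  hence "det ?B \<noteq> 0"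
    by (metis invertible_det_nz invertible_left_inverse matrix_left_invertible_ker)
  moreover have "card J = num_zero_eigenvalues A"
    using J(1) A dim_kernel_eq_num_zero_eigenvalues[of A] unfolding pos_semidef_def by metis
  ultimately show ?thesis using that by blast
qed

lemma num_zero_eigenvalues_le:
  fixes A :: "real^'n^'n"
  assumes "transpose A = A"
  shows "num_zero_eigenvalues A \<le> CARD('n)"
  using dim_subset_UNIV[of "{x. A *v x = 0}"] dim_kernel_eq_num_zero_eigenvalues[OF assms] by simp

section \<open>Permuting the coordinates\<close>

text \<open>Rows and columns each contribute the sign of \<open>p\<close>, and the two signs
  cancel.\<close>

lemma det_simultaneous_permutation:
  fixes A :: "'a::comm_ring_1^'n^'n"
  assumes p: "p permutes (UNIV :: 'n set)"
  shows "det (\<chi> i j. A $ p i $ p j) = det A"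
proof -
  have "det (\<chi> i j. A $ p i $ p j) = of_int (sign p) * det (\<chi> i. A $ p i)"
    using det_permute_columns[OF p, of "\<chi> i. A $ p i"] by simp
  also have "\<dots> = of_int (sign p * sign p) * det A"
    by (simp only: det_permute_rows[OF p] of_int_mult mult.assoc)
  finally show ?thesis by (simp only: sign_idempotent of_int_1 mult_1_left)
qed

lemma exists_permutation_of_subset:
  fixes J J' :: "'n::finite set"
  assumes "card J = card J'"
  obtains p where "p permutes UNIV" "\<And>i. p i \<in> J' \<longleftrightarrow> i \<in> J"
proof -
  obtain f where f: "bij_betw f J J'" using assms by (metis finite finite_same_card_bij)
  have "card (- J) = card (- J')" using assms by (simp add: Compl_eq_Diff_UNIV card_Diff_subset)
  then obtain g where g: "bij_betw g (- J) (- J')" by (metis finite finite_same_card_bij)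
  define p where "p i = (if i \<in> J then f i else g i)" for i
  have "bij_betw p (J \<union> - J) (J' \<union> - J')"
    unfolding p_def using bij_betw_disjoint_Un[OF f g] by auto
  hence "p permutes UNIV" by (intro bij_imp_permutes) auto
  moreover have "p i \<in> J' \<longleftrightarrow> i \<in> J" for i
    using f g by (auto simp: p_def bij_betw_def)
  ultimately show ?thesis by (rule that)
qed

section \<open>Zero sets of polynomials\<close>

lemma real_polynomial_function_finite_roots:
  fixes f :: "real \<Rightarrow> real"
  assumes "real_polynomial_function f" "f s \<noteq> 0"
  shows "finite {t. f t = 0}"
proof -
  obtain a n where f: "f = (\<lambda>x. \<Sum>i\<le>n. a i * x ^ i)"
    using real_polynomial_function_imp_sum[OF assms(1)] by blast
  have "\<exists>i\<le>n. a i \<noteq> 0"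
  proof (rule ccontr)
    assume "\<not> ?thesis"
    hence "f s = 0" by (simp add: f)
    with assms(2) show False ..
  qed
  thus ?thesis unfolding f by (simp add: polyfun_finite_roots)
qed

lemma AE_lborel_scale_translate:
  fixes a :: "'a::euclidean_space"
  assumes t: "t \<noteq> 0" and P: "Measurable.pred borel P"
    and AE: "AE x in lborel. P (a + t *\<^sub>R x)"
  shows "AE x in lborel. P x"
proof -
  have "AE x in distr lborel borel (\<lambda>x. a + t *\<^sub>R x). P x"
    using AE P by (subst AE_distr_iff) auto
  thus ?thesis
    by (subst lborel_affine[OF t, of a]) (subst AE_density, auto)
qed

text \<open>
  Every line through a point where the polynomial does not vanish meets the zero set in finitely
  many points. By Fubini, almost every dilate of the zero set about that point is a null set, and
  hence so is the zero set.
\<close>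

lemma AE_real_polynomial_function_nonzero:
  fixes g :: "'a::euclidean_space \<Rightarrow> real"
  assumes g: "real_polynomial_function g" and a: "g a \<noteq> 0"
  shows "AE x in lborel. g x \<noteq> 0"
proof -
  have [measurable]: "g \<in> borel_measurable borel"
    using g by (intro borel_measurable_continuous_onI continuous_on_polymonial_function) (simp add: real_polynomial_function_eq)
  have line: "AE t in lborel. g (a + t *\<^sub>R (x - a)) \<noteq> 0" for x
  proof -
    have "polynomial_function (\<lambda>t. a + t *\<^sub>R (x - a))"
      by (intro polynomial_function_add polynomial_function_const polynomial_function_mult
          polynomial_function_id)
    hence "real_polynomial_function (\<lambda>t. g (a + t *\<^sub>R (x - a)))"
      using real_polynomial_function_compose[OF _ g] by (simp add: o_def)
    hence "finite {t. g (a + t *\<^sub>R (x - a)) = 0}"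
      by (rule real_polynomial_function_finite_roots[of _ 0]) (simp add: a)
    hence "{t. g (a + t *\<^sub>R (x - a)) = 0} \<in> null_sets lborel"
      by (rule finite_imp_null_set_lborel)
    thus ?thesis by (rule AE_I') auto
  qed
  have "AE x in lborel. AE t in lborel. g (a + t *\<^sub>R (x - a)) \<noteq> 0"
    by (rule AE_I2) (rule line)
  hence "AE t in lborel. AE x in lborel. g (a + t *\<^sub>R (x - a)) \<noteq> 0"
    by (subst (asm) lborel_pair.AE_commute) measurable
  moreover have "AE t in lborel. (t::real) \<noteq> 0"
    by (rule AE_lborel_singleton)
  ultimately have AE: "AE t in lborel. (t::real) \<noteq> 0 \<and> (AE x in lborel. g (a + t *\<^sub>R (x - a)) \<noteq> 0)"
    by eventually_elim simp
  \<comment> \<open>The real line is not a null set, so a property of almost every \<open>t\<close>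
    holds for at least one.\<close>
  obtain t where t: "t \<noteq> 0" "AE x in lborel. g (a + t *\<^sub>R (x - a)) \<noteq> 0"
  proof (rule ccontr)
    assume "\<not> thesis"
    hence *: "\<not> (t \<noteq> 0 \<and> (AE x in lborel. g (a + t *\<^sub>R (x - a)) \<noteq> 0))" for t using that by blast
    have "AE t in (lborel :: real measure). False"
      using AE by eventually_elim (use * in blast)
    hence "emeasure lborel (UNIV :: real set) = 0"
      by (simp add: AE_iff_null null_sets_def)
    thus False by (simp add: emeasure_lborel_UNIV)
  qed
  show ?thesis
  proof (rule AE_lborel_scale_translate[OF t(1), of _ "a - t *\<^sub>R a"])
    show "AE x in lborel. g (a - t *\<^sub>R a + t *\<^sub>R x) \<noteq> 0"
      using t(2) by (simp add: algebra_simps)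
  qed measurable
qed

section \<open>Polynomials in several vectors\<close>

text \<open>Polynomial functions of a whole family of vectors. The set \<open>I\<close> records
  which members of the family may occur, matching the index set of the product measure.\<close>

inductive coord_polynomial :: "'i set \<Rightarrow> (('i \<Rightarrow> real^'n) \<Rightarrow> real) \<Rightarrow> bool" for I where
  const: "coord_polynomial I (\<lambda>_. c)"
| coord: "i \<in> I \<Longrightarrow> coord_polynomial I (\<lambda>x. x i $ j)"
| add: "coord_polynomial I f \<Longrightarrow> coord_polynomial I g \<Longrightarrow> coord_polynomial I (\<lambda>x. f x + g x)"
| mult: "coord_polynomial I f \<Longrightarrow> coord_polynomial I g \<Longrightarrow> coord_polynomial I (\<lambda>x. f x * g x)"

lemma coord_polynomial_diff:
  "coord_polynomial I f \<Longrightarrow> coord_polynomial I g \<Longrightarrow> coord_polynomial I (\<lambda>x. f x - g x)"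
  using coord_polynomial.add[OF _ coord_polynomial.mult[OF coord_polynomial.const[of I "-1"]], of f g] by simp

lemma coord_polynomial_sum:
  "(\<And>k. k \<in> K \<Longrightarrow> coord_polynomial I (f k)) \<Longrightarrow> coord_polynomial I (\<lambda>x. \<Sum>k\<in>K. f k x)"
  by (induction K rule: infinite_finite_induct) (auto intro: coord_polynomial.intros)

lemma coord_polynomial_prod:
  "(\<And>k. k \<in> K \<Longrightarrow> coord_polynomial I (f k)) \<Longrightarrow> coord_polynomial I (\<lambda>x. \<Prod>k\<in>K. f k x)"
  by (induction K rule: infinite_finite_induct) (auto intro: coord_polynomial.intros)

lemma coord_polynomial_det:
  "(\<And>i j. coord_polynomial I (\<lambda>x. F x $ i $ j)) \<Longrightarrow> coord_polynomial I (\<lambda>x. det (F x))"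
  unfolding det_def
  by (intro coord_polynomial_sum coord_polynomial.mult coord_polynomial_prod coord_polynomial.const)

text \<open>Needed because points of the product space are fixed to \<open>undefined\<close> outside
  \<open>I\<close>, whereas the data form a total family.\<close>

lemma coord_polynomial_cong:
  assumes "coord_polynomial I f" "\<And>i. i \<in> I \<Longrightarrow> x i = y i"
  shows "f x = f y"
  using assms by (induction rule: coord_polynomial.induct) auto

lemma coord_polynomial_measurable:
  assumes "coord_polynomial I f"
  shows "f \<in> borel_measurable (Pi\<^sub>M I (\<lambda>_. borel))"
  using assms
proof (induction rule: coord_polynomial.induct)
  case (coord i j)
  have "(\<lambda>y. y $ j) \<in> borel_measurable (borel :: (real^'b) measure)"
    by (intro borel_measurable_continuous_onI continuous_intros)
  thus ?case using measurable_component_singleton[OF coord] by (rule measurable_compose[rotated])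
qed auto

lemma coord_polynomial_fun_upd:
  assumes "coord_polynomial (insert i I) f"
  shows "coord_polynomial I (\<lambda>x. f (x(i := a)))"
  using assms
proof (induction rule: coord_polynomial.induct)
  case (coord k j)
  thus ?case by (cases "k = i") (auto intro: coord_polynomial.intros)
qed (auto intro: coord_polynomial.intros)

lemma coord_polynomial_section:
  assumes "coord_polynomial I f"
  shows "real_polynomial_function (\<lambda>y. f (x(i := y)))"
  using assms
proof (induction rule: coord_polynomial.induct)
  case (coord k j)
  show ?case
    by (cases "k = i") (auto intro!: real_polynomial_function.intros bounded_linear_vec_nth)
qed (auto intro: real_polynomial_function.intros)

text \<open>Induction on \<open>I\<close> with Tonelli. With vector \<open>i\<close> frozen at
  \<open>a i\<close>, almost every choice of the other vectors gives a nonzero value, so the section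
  in vector \<open>i\<close> is a polynomial that is not identically zero, hence nonzero almost
  everywhere.\<close>

lemma AE_PiM_coord_polynomial_nonzero:
  assumes I: "finite I" and f: "coord_polynomial I f" and a: "f a \<noteq> 0"
    and N: "prob_space N" "sets N = sets borel" "absolutely_continuous lborel N"
  shows "AE x in Pi\<^sub>M I (\<lambda>_. N). f x \<noteq> 0"
  using I f a
proof (induction I arbitrary: f rule: finite_induct)
  case empty
  have "f x \<noteq> 0" for x using coord_polynomial_cong[OF empty(1), of x a] empty(2) by simp
  thus ?case by simp
next
  case (insert i I)
  interpret N: prob_space N by fact
  interpret product_sigma_finite "\<lambda>_. N" by standard
  have meas: "g \<in> borel_measurable (Pi\<^sub>M J (\<lambda>_. N))" if "coord_polynomial J g" for J g
  proof -
    have "sets (Pi\<^sub>M J (\<lambda>_. N)) = sets (Pi\<^sub>M J (\<lambda>_. borel))"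
      by (intro sets_PiM_cong) (simp_all add: N)
    from measurable_cong_sets[OF this refl] coord_polynomial_measurable[OF that] show ?thesis by blast
  qed
  note [measurable] = meas[OF insert.prems(1)]
  \<comment> \<open>The measure of the zero set is written as an integral so that the product can be
    split into iterated integrals.\<close>
  let ?g = "\<lambda>x. indicator {0} (f x) :: ennreal"
  have "AE x in Pi\<^sub>M I (\<lambda>_. N). f (x(i := a i)) \<noteq> 0"
    using insert.prems by (intro insert.IH coord_polynomial_fun_upd) auto
  hence "AE x in Pi\<^sub>M I (\<lambda>_. N). (\<integral>\<^sup>+ y. ?g (x(i := y)) \<partial>N) = 0"
  proof eventually_elim
    case (elim x)
    have "AE y in lborel. f (x(i := y)) \<noteq> 0"
      by (rule AE_real_polynomial_function_nonzero[OF coord_polynomial_section[OF insert.prems(1)] elim])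
    hence "AE y in N. f (x(i := y)) \<noteq> 0"
      using N by (intro absolutely_continuous_AE[of N lborel]) auto
    hence "(\<integral>\<^sup>+ y. ?g (x(i := y)) \<partial>N) = (\<integral>\<^sup>+ y. 0 \<partial>N)"
      by (intro nn_integral_cong_AE) auto
    thus ?case by simp
  qed
  hence "(\<integral>\<^sup>+ x. (\<integral>\<^sup>+ y. ?g (x(i := y)) \<partial>N) \<partial>Pi\<^sub>M I (\<lambda>_. N)) = (\<integral>\<^sup>+ x. 0 \<partial>Pi\<^sub>M I (\<lambda>_. N))"
    by (rule nn_integral_cong_AE)
  hence "(\<integral>\<^sup>+ x. ?g x \<partial>Pi\<^sub>M (insert i I) (\<lambda>_. N)) = 0"
    by (subst product_nn_integral_insert[OF insert.hyps]) simp_all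
  hence "AE x in Pi\<^sub>M (insert i I) (\<lambda>_. N). ?g x = 0"
    by (subst (asm) nn_integral_0_iff_AE) simp_all
  thus ?case by eventually_elim (auto simp: indicator_def split: if_splits)
qed

text \<open>By independence the joint law is a power of the common law, which has a density and is
  thus absolutely continuous.\<close>

lemma (in prob_space) AE_coord_polynomial_nonzero:
  fixes X :: "'i \<Rightarrow> 'a \<Rightarrow> real^'n"
  assumes I: "finite I" "I \<noteq> {}" and ind: "indep_vars (\<lambda>_. borel) X I"
    and X: "\<And>i. i \<in> I \<Longrightarrow> distributed M lborel (X i) h"
    and f: "coord_polynomial I f" "f a \<noteq> 0"
  shows "AE \<omega> in M. f (\<lambda>i. X i \<omega>) \<noteq> 0"
proof -
  let ?N = "density lborel h"
  have rv: "random_variable borel (X i)" if "i \<in> I" for i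
    using ind that by (auto simp: indep_vars_def)
  have dX: "distr M borel (X i) = ?N" if "i \<in> I" for i
  proof -
    have "distr M borel (X i) = distr M lborel (X i)" by (rule distr_cong) auto
    thus ?thesis using distributed_distr_eq_density[OF X[OF that]] by simp
  qed
  obtain k where k: "k \<in> I" using I(2) by blast
  have N: "prob_space ?N" using prob_space_distr[OF rv[OF k]] dX[OF k] by simp
  have h: "h \<in> borel_measurable lborel" using X[OF k] by (rule distributed_borel_measurable)
  have "AE x in Pi\<^sub>M I (\<lambda>_. ?N). f x \<noteq> 0"
    by (rule AE_PiM_coord_polynomial_nonzero[OF I(1) f N])
       (auto intro!: absolutely_continuousI_density h)
  moreover have "distr M (Pi\<^sub>M I (\<lambda>_. borel)) (\<lambda>\<omega>. \<lambda>i\<in>I. X i \<omega>) = Pi\<^sub>M I (\<lambda>i. distr M borel (X i))"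
    using indep_vars_iff_distr_eq_PiM'[OF I(2), of X "\<lambda>_. borel"] rv ind by simp
  moreover have "Pi\<^sub>M I (\<lambda>i. distr M borel (X i)) = Pi\<^sub>M I (\<lambda>_. ?N)"
    using dX by (intro PiM_cong) auto
  ultimately have "AE x in distr M (Pi\<^sub>M I (\<lambda>_. borel)) (\<lambda>\<omega>. \<lambda>i\<in>I. X i \<omega>). f x \<noteq> 0" by metis
  hence "AE \<omega> in M. f (\<lambda>i\<in>I. X i \<omega>) \<noteq> 0"
  proof (subst (asm) AE_distr_iff)
    show "(\<lambda>\<omega>. \<lambda>i\<in>I. X i \<omega>) \<in> measurable M (Pi\<^sub>M I (\<lambda>_. borel))"
      using rv by (intro measurable_restrict) auto
    show "{x \<in> space (Pi\<^sub>M I (\<lambda>_. borel)). f x \<noteq> 0} \<in> sets (Pi\<^sub>M I (\<lambda>_. borel))"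
      using coord_polynomial_measurable[OF f(1)] by measurable
  qed
  moreover have "f (\<lambda>i\<in>I. X i \<omega>) = f (\<lambda>i. X i \<omega>)" for \<omega>
    by (rule coord_polynomial_cong[OF f(1)]) simp
  ultimately show ?thesis by simp
qed

section \<open>Sample covariance matrices\<close>

lemma sample_cov_about_nth:
  "sample_cov_about c n x $ j $ k = (\<Sum>i=1..n. (x i - c) $ j * (x i - c) $ k) / n"
  by (simp add: sample_cov_about_def)

text \<open>Its quadratic form at \<open>v\<close> is an average of squares of inner products with
  \<open>v\<close>.\<close>

lemma pos_semidef_sample_cov_about: "pos_semidef (sample_cov_about c n x)"
proof -
  have "v \<bullet> (sample_cov_about c n x *v v) = (\<Sum>i=1..n. ((x i - c) \<bullet> v)\<^sup>2) / n" for v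
  proof -
    have "v \<bullet> (sample_cov_about c n x *v v)
        = (\<Sum>j\<in>UNIV. \<Sum>k\<in>UNIV. \<Sum>i=1..n. (v $ j * ((x i - c) $ j * (x i - c) $ k) * v $ k) / n)"
      by (simp add: inner_vec_def matrix_vector_mult_def sample_cov_about_nth sum_distrib_left
          sum_distrib_right sum_divide_distrib mult.assoc del: vector_minus_component)
    also have "\<dots> = (\<Sum>j\<in>UNIV. \<Sum>i=1..n. \<Sum>k\<in>UNIV. (v $ j * ((x i - c) $ j * (x i - c) $ k) * v $ k) / n)"
      by (intro sum.cong refl sum.swap)
    also have "\<dots> = (\<Sum>i=1..n. \<Sum>j\<in>UNIV. \<Sum>k\<in>UNIV. (v $ j * ((x i - c) $ j * (x i - c) $ k) * v $ k) / n)"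
      by (rule sum.swap)
    also have "\<dots> = (\<Sum>i=1..n. ((x i - c) \<bullet> v)\<^sup>2) / n"
      by (simp add: inner_vec_def power2_eq_square sum_product sum_divide_distrib mult_ac
          del: vector_minus_component)
    finally show ?thesis .
  qed
  thus ?thesis
    by (auto simp: pos_semidef_def vec_eq_iff transpose_def sample_cov_about_nth mult.commute
        intro!: divide_nonneg_nonneg sum_nonneg)
qed

text \<open>The centre \<open>c\<close> is a function of the data, which covers both a known mean
  and the sample mean. The assumption \<open>equivariant\<close> lets a rearrangement of the
  coordinates of the centred data be realised by another data set.\<close>

lemma (in prob_space) AE_sample_cov_nonsingular_add_coord_diag:
  fixes X :: "nat \<Rightarrow> 'a \<Rightarrow> real^'n" and c :: "(nat \<Rightarrow> real^'n) \<Rightarrow> real^'n"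
  assumes n: "n \<ge> 1" and ind: "indep_vars (\<lambda>_. borel) X {1..n}"
    and X: "\<And>i. i \<in> {1..n} \<Longrightarrow> distributed M lborel (X i) h"
    and c: "\<And>j. coord_polynomial {1..n} (\<lambda>x. c x $ j)"
    and equivariant: "\<And>x p. \<exists>x'. \<forall>i\<in>{1..n}. \<forall>j. (x' i - c x') $ j = (x i - c x) $ p j"
    and zeros: "AE \<omega> in M. num_zero_eigenvalues (sample_cov_about (c (\<lambda>i. X i \<omega>)) n (\<lambda>i. X i \<omega>)) = m"
    and J: "card J = m"
  shows "AE \<omega> in M. det (sample_cov_about (c (\<lambda>i. X i \<omega>)) n (\<lambda>i. X i \<omega>) + coord_diag J (\<lambda>_. 1)) \<noteq> 0"
proof -
  let ?S = "\<lambda>x. sample_cov_about (c x) n x"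
  let ?f = "\<lambda>x. det (?S x + coord_diag J (\<lambda>_. 1))"
  \<comment> \<open>An almost sure event is nonempty, so an outcome itself supplies the data point
    and no explicit data set has to be constructed.\<close>
  have "\<exists>\<omega>. num_zero_eigenvalues (?S (\<lambda>i. X i \<omega>)) = m"
  proof (rule ccontr)
    assume "\<not> ?thesis"
    with zeros have "AE \<omega> in M. False" by simp
    thus False by simp
  qed
  then obtain a where a: "num_zero_eigenvalues (?S a) = m" by blast
  obtain J' where J': "card J' = m" "det (?S a + coord_diag J' (\<lambda>_. 1)) \<noteq> 0"
    using exists_nonsingular_coord_diag[OF pos_semidef_sample_cov_about, of "c a" n a] a by metis
  obtain p where p: "p permutes (UNIV :: 'n set)" "\<And>i. p i \<in> J' \<longleftrightarrow> i \<in> J"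
    using exists_permutation_of_subset[of J J'] J J'(1) by metis
  obtain x where x: "\<forall>i\<in>{1..n}. \<forall>j. (x i - c x) $ j = (a i - c a) $ p j"
    using equivariant by blast
  \<comment> \<open>Since \<open>p\<close> maps \<open>J\<close> onto \<open>J'\<close> and its
    complement onto the complement of \<open>J'\<close>, both summands are rearranged by the same
    permutation of rows and columns.\<close>
  have "?S x + coord_diag J (\<lambda>_. 1) = (\<chi> i j. (?S a + coord_diag J' (\<lambda>_. 1)) $ p i $ p j)"
    using x p(2) permutes_inj[OF p(1)]
    by (auto simp: vec_eq_iff sample_cov_about_nth coord_diag_def diag_mat_def inj_eq
        simp del: vector_minus_component intro!: arg_cong[where f = "\<lambda>s. s / _"] sum.cong)
  hence "?f x \<noteq> 0" using J'(2) by (simp only: det_simultaneous_permutation[OF p(1)] not_False_eq_True)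
  moreover have "coord_polynomial {1..n} (\<lambda>x. (?S x + coord_diag J (\<lambda>_. 1)) $ i $ j)" for i j
    unfolding divide_inverse vector_add_component sample_cov_about_nth vector_minus_component
    by (intro coord_polynomial.add coord_polynomial.mult coord_polynomial_diff
        coord_polynomial_sum coord_polynomial.coord coord_polynomial.const c)
  hence "coord_polynomial {1..n} ?f" by (rule coord_polynomial_det)
  ultimately show ?thesis
    using n by (intro AE_coord_polynomial_nonzero[OF _ _ ind X]) auto
qed

theorem corollary2:
  fixes M :: "'a measure"
    and X :: "nat \<Rightarrow> 'a \<Rightarrow> real^('p::{finite,linorder})"
    and \<mu> :: "real^('p::{finite,linorder})"
    and \<Theta>\<^sub>0 :: "real^('p::{finite,linorder})^('p::{finite,linorder})"
    and S :: "'a \<Rightarrow> real^('p::{finite,linorder})^('p::{finite,linorder})"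
    and n m\<^sub>0 :: nat
    and pen\<^sub>D pen :: "real \<Rightarrow> real"
  assumes "prob_space M"
    and "n \<ge> 1"
    and "pos_def \<Theta>\<^sub>0"
    and "prob_space.indep_vars M (\<lambda>_. borel) X {1..n}"
    and "\<And>i. i \<in> {1..n} \<Longrightarrow>
           distributed M lborel (X i) (\<lambda>x. ennreal (mvn_density \<mu> (matrix_inv \<Theta>\<^sub>0) x))"
    and "S = (\<lambda>\<omega>. sample_cov_about (sample_mean n (\<lambda>i. X i \<omega>)) n (\<lambda>i. X i \<omega>)) \<or>
         S = (\<lambda>\<omega>. sample_cov_about \<mu> n (\<lambda>i. X i \<omega>))"
    and "AE \<omega> in M. num_zero_eigenvalues (S \<omega>) = m\<^sub>0"
    and "diag_penalty pen\<^sub>D"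
    and "offdiag_penalty pen"
    and "Liminf at_top (\<lambda>x. ereal (pen\<^sub>D x / ln x)) > ereal (real m\<^sub>0 / real CARD('p))"
  shows "AE \<omega> in M. pen_estimate_exists pen\<^sub>D pen (S \<omega>)"
proof -
  interpret prob_space M by fact
  have "\<exists>c. S = (\<lambda>\<omega>. sample_cov_about (c (\<lambda>i. X i \<omega>)) n (\<lambda>i. X i \<omega>)) \<and>
      (\<forall>j. coord_polynomial {1..n} (\<lambda>x. c x $ j)) \<and>
      (\<forall>x p. \<exists>x'. \<forall>i\<in>{1..n}. \<forall>j. (x' i - c x') $ j = (x i - c x) $ p j)"
    using assms(6)
  proof
    assume "S = (\<lambda>\<omega>. sample_cov_about (sample_mean n (\<lambda>i. X i \<omega>)) n (\<lambda>i. X i \<omega>))"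
    moreover have "coord_polynomial {1..n} (\<lambda>x. sample_mean n x $ j)" for j :: 'p
      unfolding sample_mean_def vector_scaleR_component sum_component real_scaleR_def
      by (intro coord_polynomial.mult coord_polynomial_sum coord_polynomial.coord coord_polynomial.const)
    moreover have "\<exists>x'. \<forall>i\<in>{1..n}. \<forall>j. (x' i - sample_mean n x') $ j = (x i - sample_mean n x) $ p j"
      for x :: "nat \<Rightarrow> (real, 'p) vec" and p
      \<comment> \<open>Rearranging the raw data rearranges the sample mean in the same way.\<close>
      by (rule exI[of _ "\<lambda>i. \<chi> j. x i $ p j"]) (simp add: sample_mean_def)
    ultimately show ?thesis by blast
  next
    assume "S = (\<lambda>\<omega>. sample_cov_about \<mu> n (\<lambda>i. X i \<omega>))"
    moreover have "\<exists>x'. \<forall>i\<in>{1..n}. \<forall>j. (x' i - \<mu>) $ j = (x i - \<mu>) $ p j"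
      for x :: "nat \<Rightarrow> (real, 'p) vec" and p
      \<comment> \<open>Here the deviations are rearranged and \<open>\<mu>\<close> is added back,
        because \<open>\<mu>\<close> itself need not be invariant.\<close>
      by (rule exI[of _ "\<lambda>i. \<mu> + (\<chi> j. (x i - \<mu>) $ p j)"]) simp
    ultimately show ?thesis
      by (intro exI[of _ "\<lambda>_. \<mu>"]) (simp add: coord_polynomial.const)
  qed
  then obtain c where S: "S = (\<lambda>\<omega>. sample_cov_about (c (\<lambda>i. X i \<omega>)) n (\<lambda>i. X i \<omega>))"
    and c: "\<And>j. coord_polynomial {1..n} (\<lambda>x. c x $ j)"
    and equivariant: "\<And>x p. \<exists>x'. \<forall>i\<in>{1..n}. \<forall>j. (x' i - c x') $ j = (x i - c x) $ p j"
    by blast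
  have "AE \<omega> in M. det (S \<omega> + coord_diag J (\<lambda>_. 1)) \<noteq> 0" if "card J = m\<^sub>0" for J
    using AE_sample_cov_nonsingular_add_coord_diag[OF assms(2,4,5) c equivariant _ that] assms(7)
    unfolding S by blast
  \<comment> \<open>There are only finitely many index sets, so one null set serves them all; the
    choice of \<open>J\<close> in the deterministic bound may then depend on the matrix
    argument.\<close>
  hence "AE \<omega> in M. \<forall>J\<in>{J. card J = m\<^sub>0}. det (S \<omega> + coord_diag J (\<lambda>_. 1)) \<noteq> 0"
    by (intro AE_finite_allI) auto
  with assms(7) show ?thesis
  proof eventually_elim
    case (elim \<omega>)
    have psd: "pos_semidef (S \<omega>)" unfolding S by (rule pos_semidef_sample_cov_about)
    \<comment> \<open>The bound is read off from the outcome at hand, where \<open>m\<^sub>0\<close>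
      is the dimension of a kernel.\<close>
    hence "m\<^sub>0 \<le> CARD('p)"
      using num_zero_eigenvalues_le[of "S \<omega>"] elim(1) by (simp add: pos_semidef_def)
    thus ?case
      using elim(2) by (intro pen_estimate_existsI[OF psd _ _ assms(8-10)]) auto
  qed
qed

end
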